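(* For each pair of integers $n,m$ with $n\geq 7$ and $n\leq m\leq \binom{n-3}{2}+3$, there is no uniformly most split reliable two-terminal graph in $T_{n,m}$.
   Context: A two-terminal graph is a connected simple graph with two distinct distinguished vertices $s,t$ (terminals). Two two-terminal graphs are isomorphic if there is a graph isomorphism mapping the terminal set onto the terminal set. $T_{n,m}$ is the set of all nonisomorphic connected simple two-terminal graphs with $n$ vertices and $m$ edges. A split subgraph of $G$ is a spanning subgraph of $G$ with exactly two connected components, one containing $s$ and the other containing $t$. The split reliability $SR_G(p)$ is the probability that, when each edge of $G$ is independently deleted with probability $1-p$, the resulting spanning subgraph is a split subgraph. $G\in T_{n,m}$ is uniformly most split reliable if $SR_G(p)\geq SR_H(p)$ for every $H\in T_{n,m}$ and every $p\in[0,1]$. *)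

theory Defs
  imports "HOL-Probability.Probability"
begin

section \<open>Graphs\<close>

text \<open>Undirected simple graphs are given by a vertex set and a set of two-element edges.\<close>

definition adj :: "'a set set \<Rightarrow> ('a \<times> 'a) set" where
  "adj E = {(u, v). {u, v} \<in> E}"

definition simple_graph :: "'a set \<Rightarrow> 'a set set \<Rightarrow> bool" where
  "simple_graph V E \<longleftrightarrow> finite V \<and> (\<forall>e\<in>E. e \<subseteq> V \<and> card e = 2)"

definition connected_graph :: "'a set \<Rightarrow> 'a set set \<Rightarrow> bool" where
  "connected_graph V E \<longleftrightarrow> V \<noteq> {} \<and> (\<forall>u\<in>V. \<forall>v\<in>V. (u, v) \<in> (adj E)\<^sup>*)"

definition components_of_graph :: "'a set \<Rightarrow> 'a set set \<Rightarrow> 'a set set" where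
  "components_of_graph V E = {{v \<in> V. (u, v) \<in> (adj E)\<^sup>*} | u. u \<in> V}"

section \<open>Two-terminal graphs\<close>

record 'a two_terminal_graph =
  verts :: "'a set"
  edges :: "'a set set"
  source :: 'a
  sink :: 'a

definition is_two_terminal_graph :: "'a two_terminal_graph \<Rightarrow> bool" where
  "is_two_terminal_graph G \<longleftrightarrow>
     simple_graph (verts G) (edges G) \<and> connected_graph (verts G) (edges G) \<and>
     source G \<in> verts G \<and> sink G \<in> verts G \<and> source G \<noteq> sink G"

text \<open>The terminals are only preserved as a set, so they may be exchanged.\<close>

definition isomorphic :: "'a two_terminal_graph \<Rightarrow> 'a two_terminal_graph \<Rightarrow> bool" where
  "isomorphic G H \<longleftrightarrow>
     (\<exists>f. bij_betw f (verts G) (verts H) \<and>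
          (\<forall>u\<in>verts G. \<forall>v\<in>verts G. {u, v} \<in> edges G \<longleftrightarrow> {f u, f v} \<in> edges H) \<and>
          f ` {source G, sink G} = {source H, sink H})"

text \<open>Every finite graph has a copy whose vertices are natural numbers, so graphs
  on finite sets of natural numbers represent all isomorphism classes.\<close>

definition two_terminal_graphs :: "nat \<Rightarrow> nat \<Rightarrow> nat two_terminal_graph set" where
  "two_terminal_graphs n m =
     {G. is_two_terminal_graph G \<and> card (verts G) = n \<and> card (edges G) = m}"

definition iso_rel :: "nat two_terminal_graph rel" where
  "iso_rel = {(G, H). is_two_terminal_graph G \<and> is_two_terminal_graph H \<and> isomorphic G H}"

definition T :: "nat \<Rightarrow> nat \<Rightarrow> nat two_terminal_graph set set" where
  "T n m = two_terminal_graphs n m // iso_rel"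

section \<open>Split reliability\<close>

definition is_split_subgraph :: "'a two_terminal_graph \<Rightarrow> 'a set set \<Rightarrow> bool" where
  "is_split_subgraph G F \<longleftrightarrow> F \<subseteq> edges G \<and>
     (\<exists>A B. A \<noteq> B \<and> components_of_graph (verts G) F = {A, B} \<and> source G \<in> A \<and> sink G \<in> B)"

text \<open>The random function \<open>x\<close> records which edges survive, each one independently with
  probability \<open>p\<close>.\<close>

definition split_reliability :: "'a two_terminal_graph \<Rightarrow> real \<Rightarrow> real" where
  "split_reliability G p =
     measure_pmf.prob (Pi_pmf (edges G) False (\<lambda>_. bernoulli_pmf p))
       {x. is_split_subgraph G {e \<in> edges G. x e}}"

text \<open>Here \<open>C\<close> and \<open>D\<close> are isomorphism classes. By \<open>split_reliability_isomorphic\<close> below, the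
  choice of the representatives \<open>G\<close> and \<open>H\<close> does not matter.\<close>

definition uniformly_most_split_reliable ::
    "nat \<Rightarrow> nat \<Rightarrow> nat two_terminal_graph set \<Rightarrow> bool" where
  "uniformly_most_split_reliable n m C \<longleftrightarrow>
     (\<forall>D\<in>T n m. \<forall>p\<in>{0..1}. \<forall>G\<in>C. \<forall>H\<in>D. split_reliability G p \<ge> split_reliability H p)"

section \<open>Invariance under isomorphism\<close>

lemma isomorphic_refl: "isomorphic G G"
  unfolding isomorphic_def by (rule exI[of _ id]) auto

lemma isomorphic_sym:
  assumes "is_two_terminal_graph G" "isomorphic G H"
  shows "isomorphic H G"
proof -
  obtain f where f: "bij_betw f (verts G) (verts H)"
      "\<forall>u\<in>verts G. \<forall>v\<in>verts G. {u, v} \<in> edges G \<longleftrightarrow> {f u, f v} \<in> edges H"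
      "f ` {source G, sink G} = {source H, sink H}"
    using assms(2) unfolding isomorphic_def by blast
  have st: "source G \<in> verts G" "sink G \<in> verts G"
    using assms(1) by (auto simp: is_two_terminal_graph_def)
  let ?g = "the_inv_into (verts G) f"
  have inj: "inj_on f (verts G)" and im: "f ` verts G = verts H"
    using f(1) by (auto simp: bij_betw_def)
  have g: "bij_betw ?g (verts H) (verts G)"
    by (rule bij_betw_the_inv_into[OF f(1)])
  have fg: "f (?g u) = u" "?g u \<in> verts G" if "u \<in> verts H" for u
    using that inj im g by (auto simp: f_the_inv_into_f bij_betw_def)
  have "?g ` {source H, sink H} = ?g ` f ` {source G, sink G}"
    using f(3) by simp
  also have "\<dots> = {source G, sink G}"
    using st inj by (simp add: the_inv_into_f_f)
  finally show ?thesis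
    unfolding isomorphic_def using g f(2) fg by (intro exI[of _ ?g]) metis
qed

lemma isomorphic_trans:
  assumes "isomorphic G H" "isomorphic H K"
  shows "isomorphic G K"
proof -
  obtain f where f: "bij_betw f (verts G) (verts H)"
      "\<forall>u\<in>verts G. \<forall>v\<in>verts G. {u, v} \<in> edges G \<longleftrightarrow> {f u, f v} \<in> edges H"
      "f ` {source G, sink G} = {source H, sink H}"
    using assms(1) unfolding isomorphic_def by blast
  obtain g where g: "bij_betw g (verts H) (verts K)"
      "\<forall>u\<in>verts H. \<forall>v\<in>verts H. {u, v} \<in> edges H \<longleftrightarrow> {g u, g v} \<in> edges K"
      "g ` {source H, sink H} = {source K, sink K}"
    using assms(2) unfolding isomorphic_def by blast
  have mem: "f u \<in> verts H" if "u \<in> verts G" for u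
    using that f(1) by (auto simp: bij_betw_def)
  have st: "(g \<circ> f) ` {source G, sink G} = {source K, sink K}"
    using f(3) g(3) by (metis image_comp)
  show ?thesis
    unfolding isomorphic_def
    using bij_betw_trans[OF f(1) g(1)] f(2) g(2) mem st
    by (intro exI[of _ "g \<circ> f"]) simp
qed

lemma equiv_iso_rel: "equiv {G. is_two_terminal_graph G} iso_rel"
proof (rule equivI)
  show "iso_rel \<subseteq> {G. is_two_terminal_graph G} \<times> {G. is_two_terminal_graph G}"
    by (auto simp: iso_rel_def)
  show "refl_on {G. is_two_terminal_graph G} iso_rel"
    by (auto simp: refl_on_def iso_rel_def isomorphic_refl)
  show "sym iso_rel"
    by (auto simp: sym_def iso_rel_def intro: isomorphic_sym)
  show "trans iso_rel"
    unfolding trans_def iso_rel_def using isomorphic_trans by blast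
qed

lemma adj_in_verts:
  assumes "simple_graph V E" "(a, b) \<in> adj E"
  shows "a \<in> V" "b \<in> V"
proof -
  have "{a, b} \<in> E" using assms(2) by (simp add: adj_def)
  moreover have "\<forall>e\<in>E. e \<subseteq> V \<and> card e = 2"
    using assms(1) unfolding simple_graph_def by (rule conjunct2)
  ultimately have "{a, b} \<subseteq> V \<and> card {a, b} = 2" by (rule bspec[rotated])
  then have "{a, b} \<subseteq> V" by (rule conjunct1)
  then show "a \<in> V" "b \<in> V" by simp_all
qed

lemma adj_image:
  assumes "simple_graph V E" "inj_on f V"
  shows "adj ((`) f ` E) = map_prod f f ` adj E"
proof (intro equalityI subsetI)
  fix z assume "z \<in> adj ((`) f ` E)"
  then obtain a b e where z: "z = (a, b)" "{a, b} = f ` e" "e \<in> E"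
    by (auto simp: adj_def)
  then have e: "e \<subseteq> V" "card e = 2"
    using assms(1) by (auto simp: simple_graph_def)
  then obtain u v where uv: "e = {u, v}" "u \<noteq> v"
    by (auto simp: card_2_iff)
  have "{a, b} = {f u, f v}"
    using z uv by auto
  then consider "a = f u" "b = f v" | "a = f v" "b = f u"
    by (auto simp: doubleton_eq_iff)
  then show "z \<in> map_prod f f ` adj E"
  proof cases
    case 1
    then have "z = map_prod f f (u, v)" "(u, v) \<in> adj E"
      using z uv by (auto simp: adj_def)
    then show ?thesis by blast
  next
    case 2
    then have "z = map_prod f f (v, u)" "(v, u) \<in> adj E"
      using z uv by (auto simp: adj_def insert_commute)
    then show ?thesis by blast
  qed
next
  fix z assume "z \<in> map_prod f f ` adj E"
  then obtain a b where ab: "z = (f a, f b)" "{a, b} \<in> E"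
    by (auto simp: adj_def)
  then have "f ` {a, b} \<in> (`) f ` E" by blast
  then show "z \<in> adj ((`) f ` E)"
    using ab by (simp add: adj_def)
qed

lemma rtrancl_adj_image:
  assumes "simple_graph V E" "inj_on f V" "u \<in> V" "v \<in> V"
  shows "(f u, f v) \<in> (adj ((`) f ` E))\<^sup>* \<longleftrightarrow> (u, v) \<in> (adj E)\<^sup>*"
proof (rule iffI)
  note sub = adj_in_verts[OF assms(1)]
  have lift: "\<exists>v\<in>V. y = f v \<and> (u, v) \<in> (adj E)\<^sup>*" if "(f u, y) \<in> (adj ((`) f ` E))\<^sup>*" for y
    using that
  proof (induction rule: rtrancl_induct)
    case base
    show ?case using assms(3) by blast
  next
    case (step y z)
    from step.IH obtain v where v: "v \<in> V" "y = f v" "(u, v) \<in> (adj E)\<^sup>*" by blast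
    have "(y, z) \<in> map_prod f f ` adj E"
      using step.hyps(2) adj_image[OF assms(1,2)] by simp
    then obtain c where c: "(y, z) = map_prod f f c" "c \<in> adj E" by (rule imageE)
    obtain a b where "c = (a, b)" by (rule prod.exhaust)
    with c have ab: "(a, b) \<in> adj E" "y = f a" "z = f b" by simp_all
    have "f a = f v" using ab(2) v(2) by (rule subst)
    then have "a = v" using sub(1)[OF ab(1)] v(1) by (rule inj_onD[OF assms(2)])
    then have "(v, b) \<in> adj E" using ab(1) by (rule subst)
    with v(3) have "(u, b) \<in> (adj E)\<^sup>*" by (rule rtrancl.rtrancl_into_rtrancl)
    then show ?case using ab(3) sub(2)[OF ab(1)] by blast
  qed
  assume "(f u, f v) \<in> (adj ((`) f ` E))\<^sup>*"
  from lift[OF this] obtain w where "w \<in> V" "f v = f w" "(u, w) \<in> (adj E)\<^sup>*" by blast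
  then show "(u, v) \<in> (adj E)\<^sup>*"
    using inj_onD[OF assms(2), of v w] assms(4) by simp
next
  assume "(u, v) \<in> (adj E)\<^sup>*"
  then show "(f u, f v) \<in> (adj ((`) f ` E))\<^sup>*"
  proof (induction rule: rtrancl_induct)
    case base
    show ?case by (rule rtrancl.rtrancl_refl)
  next
    case (step y z)
    have "map_prod f f (y, z) \<in> map_prod f f ` adj E"
      using step.hyps(2) by (rule imageI)
    then have "(f y, f z) \<in> adj ((`) f ` E)"
      by (simp add: adj_image[OF assms(1,2)])
    with step.IH show ?case by (rule rtrancl.rtrancl_into_rtrancl)
  qed
qed

lemma components_of_graph_image:
  assumes "simple_graph V E" "inj_on f V"
  shows "components_of_graph (f ` V) ((`) f ` E) = (`) f ` components_of_graph V E"
proof -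
  have "{v \<in> f ` V. (f u, v) \<in> (adj ((`) f ` E))\<^sup>*} = f ` {v \<in> V. (u, v) \<in> (adj E)\<^sup>*}"
    if "u \<in> V" for u
    using rtrancl_adj_image[OF assms that] by auto
  then show ?thesis
    unfolding components_of_graph_def by (fastforce simp: Setcompr_eq_image image_image)
qed

lemma split_reliability_isomorphic:
  fixes G H :: "'a two_terminal_graph"
  assumes "is_two_terminal_graph G" "is_two_terminal_graph H" "isomorphic G H"
  shows "split_reliability G p = split_reliability H p"
proof -
  obtain f where f: "bij_betw f (verts G) (verts H)"
      "\<forall>u\<in>verts G. \<forall>v\<in>verts G. {u, v} \<in> edges G \<longleftrightarrow> {f u, f v} \<in> edges H"
      "f ` {source G, sink G} = {source H, sink H}"
    using assms(3) unfolding isomorphic_def by blast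
  have sG: "simple_graph (verts G) (edges G)" and sH: "simple_graph (verts H) (edges H)"
    and st: "source G \<in> verts G" "sink G \<in> verts G"
    using assms by (auto simp: is_two_terminal_graph_def)
  have inj: "inj_on f (verts G)" and im: "f ` verts G = verts H"
    using f(1) by (auto simp: bij_betw_def)
  have fin: "finite (edges G)"
    using sG unfolding simple_graph_def by (meson PowI finite_Pow_iff finite_subset subsetI)
  have imE: "(`) f ` edges G = edges H"
  proof (intro equalityI subsetI)
    fix e assume "e \<in> (`) f ` edges G"
    then obtain d where d: "d \<in> edges G" "e = f ` d" by blast
    then have "d \<subseteq> verts G" "card d = 2" using sG by (auto simp: simple_graph_def)
    then obtain u v where "d = {u, v}" by (auto simp: card_2_iff)
    with d \<open>d \<subseteq> verts G\<close> show "e \<in> edges H" using f(2) by auto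
  next
    fix e assume e: "e \<in> edges H"
    then have "e \<subseteq> f ` verts G" "card e = 2" using sH im by (auto simp: simple_graph_def)
    then obtain u v where "e = {f u, f v}" "u \<in> verts G" "v \<in> verts G"
      by (auto simp: card_2_iff)
    with e have "{u, v} \<in> edges G" "e = f ` {u, v}" using f(2) by auto
    then show "e \<in> (`) f ` edges G" by blast
  qed
  have "inj_on ((`) f) (edges G)"
    using sG inj by (intro inj_on_subset[OF inj_on_image_Pow[OF inj]]) (auto simp: simple_graph_def)
  then have bij: "bij_betw ((`) f) (edges G) (edges H)"
    using imE by (auto simp: bij_betw_def)
  have split: "is_split_subgraph H ((`) f ` F) \<longleftrightarrow> is_split_subgraph G F"
    if F: "F \<subseteq> edges G" for F
  proof -
    let ?C = "components_of_graph (verts G) F"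
    have sF: "simple_graph (verts G) F" using sG F by (auto simp: simple_graph_def)
    have CH: "components_of_graph (verts H) ((`) f ` F) = (`) f ` ?C"
      using components_of_graph_image[OF sF inj] im by simp
    have sub: "A \<subseteq> verts G" if "A \<in> ?C" for A
      using that by (auto simp: components_of_graph_def)
    have mem: "f x \<in> f ` A \<longleftrightarrow> x \<in> A" if "A \<in> ?C" "x \<in> verts G" for A x
      using inj_on_image_mem_iff[OF inj that(2) sub[OF that(1)]] .
    have eq: "f ` A = f ` B \<longleftrightarrow> A = B" if "A \<in> ?C" "B \<in> ?C" for A B
      using inj_on_image_eq_iff[OF inj sub[OF that(1)] sub[OF that(2)]] .
    have FH: "(`) f ` F \<subseteq> edges H" using F imE by blast
    define P where "P S x y \<longleftrightarrow> (\<exists>A B. A \<noteq> B \<and> S = {A, B} \<and> x \<in> A \<and> y \<in> B)"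
      for S and x y :: 'a
    have comm: "P S x y \<longleftrightarrow> P S y x" for S x y
      unfolding P_def by (metis insert_commute)
    have P_image: "P ((`) f ` ?C) (f x) (f y) \<longleftrightarrow> P ?C x y" if "x \<in> verts G" "y \<in> verts G" for x y
    proof
      assume "P ((`) f ` ?C) (f x) (f y)"
      then obtain A B where AB: "A \<noteq> B" "(`) f ` ?C = {A, B}" "f x \<in> A" "f y \<in> B"
        unfolding P_def by blast
      have "A \<in> (`) f ` ?C" "B \<in> (`) f ` ?C" unfolding AB(2) by simp_all
      then obtain A' B' where AB': "A' \<in> ?C" "B' \<in> ?C" "A = f ` A'" "B = f ` B'"
        by (elim imageE)
      have "D = A' \<or> D = B'" if D: "D \<in> ?C" for D
      proof -
        have "f ` D \<in> {A, B}" using D unfolding AB(2)[symmetric] by (rule imageI)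
        then have "f ` D = f ` A' \<or> f ` D = f ` B'" unfolding AB'(3,4) by simp
        then show ?thesis unfolding eq[OF D AB'(1)] eq[OF D AB'(2)] .
      qed
      then have "?C = {A', B'}" using AB'(1,2) by blast
      moreover have "A' \<noteq> B'"
        using AB(1) unfolding AB'(3,4) by blast
      moreover have "x \<in> A'" "y \<in> B'"
        using AB(3,4) unfolding AB'(3,4) mem[OF AB'(1) that(1)] mem[OF AB'(2) that(2)] .
      ultimately show "P ?C x y"
        unfolding P_def by (intro exI[of _ A'] exI[of _ B']) simp
    next
      assume "P ?C x y"
      then obtain A B where AB: "A \<noteq> B" "?C = {A, B}" "x \<in> A" "y \<in> B"
        unfolding P_def by blast
      then have "f ` A \<noteq> f ` B" using eq[of A B] by simp
      then show "P ((`) f ` ?C) (f x) (f y)"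
        unfolding P_def AB(2) using AB(3,4) by (intro exI[of _ "f ` A"] exI[of _ "f ` B"]) simp
    qed
    from f(3) have "source H = f (source G) \<and> sink H = f (sink G) \<or>
        source H = f (sink G) \<and> sink H = f (source G)"
      by (auto simp: doubleton_eq_iff)
    then have "P ((`) f ` ?C) (source H) (sink H) \<longleftrightarrow> P ?C (source G) (sink G)"
    proof (elim disjE conjE)
      assume H: "source H = f (source G)" "sink H = f (sink G)"
      show ?thesis unfolding H by (rule P_image[OF st])
    next
      assume H: "source H = f (sink G)" "sink H = f (source G)"
      show ?thesis unfolding H comm[of ?C "source G"] by (rule P_image[OF st(2,1)])
    qed
    then show ?thesis
      using F FH unfolding is_split_subgraph_def CH P_def by simp
  qed
  define h where "h e = (if e \<in> edges G then f ` e else {})" for e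
  have hbij: "bij_betw h (edges G) (edges H)"
    using bij by (rule bij_betw_cong[THEN iffD1, rotated]) (simp add: h_def)
  have hout: "h e \<notin> edges H" if "e \<notin> edges G" for e
    using that sH by (auto simp: h_def simple_graph_def)
  have "is_split_subgraph G {e \<in> edges G. (x \<circ> h) e} \<longleftrightarrow> is_split_subgraph H {e \<in> edges H. x e}"
    for x
  proof -
    have "{e \<in> edges H. x e} = (`) f ` {e \<in> edges G. (x \<circ> h) e}"
      unfolding imE[symmetric] by (auto simp: h_def)
    then show ?thesis using split[of "{e \<in> edges G. (x \<circ> h) e}"] by simp
  qed
  moreover have "Pi_pmf (edges G) False (\<lambda>_. bernoulli_pmf p) =
      map_pmf (\<lambda>x. x \<circ> h) (Pi_pmf (edges H) False (\<lambda>_. bernoulli_pmf p))"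
    by (rule Pi_pmf_bij_betw[OF fin hbij hout])
  ultimately show ?thesis
    unfolding split_reliability_def by (simp add: vimage_def)
qed

end

(* Near p = 1 the split reliability is governed by the number b of edges whose removal separates
   s from t (bridges), near p = 0 by the number of split forests, i.e. split subgraphs with n - 2
   edges.  An optimal graph therefore maximises both.  A path of c edges attached to an almost
   complete graph has c bridges, so maximality of b yields b >= 3 and a lower bound for m in terms
   of n and b.  Given these, another graph has strictly more split forests.

   Let tau be the number of spanning trees.  Contracting a bridge f and subdividing an edge e that
   is not a bridge keeps n and m; it loses the at most tau split forests avoiding f, and gains one
   for every split forest that contains f and avoids e.  Averaging over e, some e gains more than
   it loses, provided that some split forest contains all bridges.  Otherwise the bridges form a
   path from s to t, and shifting the end of one bridge to a neighbouring vertex off the path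
   suffices. *)
theory Submission
  imports Defs
begin

section \<open>Reachability\<close>

text \<open>A hypothetical optimal graph is known only through n, m and its number b of bridges, so
  its competitor has to be built from the graph itself. Fix a bridge f and count pairs (F, e), where
  F is a split forest containing f and e an edge outside F that is not a bridge. Deleting a bridge
  other than f from a tree gives (b-1) tau forests with m-n+1 such edges each; each of the Phi split
  forests that contain all bridges has m-n+2. As tau < Phi (m-n+2) when the bridges do not join s to
  t, the total exceeds tau ((b-1)(m-n+1) + 1), and averaging over the m-b candidates e works once
  m-b is at most (b-1)(m-n+1) + 1. Maximality of b guarantees this for b >= 3; n = 7, m = 8, b = 3
  gives equality, so even the strictness of tau < Phi (m-n+2) counts. If the bridges join s to t,
  then Phi = 0 and the argument breaks down, hence the second construction. The upper bound on m is
  the edge number of a complete graph on n-3 vertices with a path of 3 edges attached.\<close>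

definition reach :: "'a set set \<Rightarrow> 'a \<Rightarrow> 'a \<Rightarrow> bool" where
  "reach F u v \<longleftrightarrow> (u, v) \<in> (adj F)\<^sup>*"

lemma reach_refl [simp]: "reach F u u"
  by (simp add: reach_def)

lemma reach_empty [simp]: "reach {} u v \<longleftrightarrow> u = v"
proof -
  have "adj {} = ({} :: ('a \<times> 'a) set)" by (auto simp: adj_def)
  then show ?thesis unfolding reach_def by simp
qed

lemma reach_edge: "{u, v} \<in> F \<Longrightarrow> reach F u v"
  by (auto simp: reach_def adj_def)

lemma reach_trans [trans]: "reach F u v \<Longrightarrow> reach F v w \<Longrightarrow> reach F u w"
  by (auto simp: reach_def)

lemma reach_sym: "reach F u v \<Longrightarrow> reach F v u"
proof -
  have "sym (adj F)"
    by (auto simp: sym_def adj_def insert_commute)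
  then show "reach F u v \<Longrightarrow> reach F v u"
    unfolding reach_def by (meson sym_rtrancl symD)
qed

text \<open>An edge may turn into a walk or collapse to a point, so the same principle serves for
  enlarging an edge set, rerouting a single edge and contracting a bridge.\<close>

lemma reach_hom:
  assumes "reach F u v" and "\<And>c d. {c, d} \<in> F \<Longrightarrow> reach W (h c) (h d)"
  shows "reach W (h u) (h v)"
  using assms(1) unfolding reach_def
proof (induction rule: rtrancl_induct)
  case (step y z)
  then show ?case using assms(2)[of y z] by (auto simp: reach_def adj_def)
qed simp

lemma reach_mono: "reach F u v \<Longrightarrow> F \<subseteq> W \<Longrightarrow> reach W u v"
  using reach_hom[of F u v W "\<lambda>x. x"] by (blast intro: reach_edge)

lemma reach_crossing:
  assumes "reach F u v" "u \<in> U" "v \<notin> U"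
  obtains a b where "a \<in> U" "b \<notin> U" "{a, b} \<in> F"
proof -
  have "\<exists>a b. a \<in> U \<and> b \<notin> U \<and> {a, b} \<in> F"
    using assms unfolding reach_def
    by (induction rule: rtrancl_induct) (auto simp: adj_def)
  then show thesis using that by blast
qed

text \<open>A walk that uses the new edge repeatedly can be shortened to use it at most once, in one
  of two directions. In what follows this replaces arguments about paths and cycles.\<close>

lemma reach_insert:
  "reach (insert {a, b} F) u v \<longleftrightarrow>
     reach F u v \<or> reach F u a \<and> reach F b v \<or> reach F u b \<and> reach F a v"
  (is "_ \<longleftrightarrow> ?R v")
proof
  assume "reach (insert {a, b} F) u v"
  then show "?R v"
    unfolding reach_def[of "insert {a, b} F"]
  proof (induction rule: rtrancl_induct)
    case base
    show ?case by simp
  next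
    case (step y z)
    then have "{y, z} = {a, b} \<or> reach F y z"
      by (auto simp: adj_def intro: reach_edge)
    then consider "y = a" "z = b" | "y = b" "z = a" | "reach F y z"
      by (auto simp: doubleton_eq_iff)
    then show ?case
      using step.IH by cases (auto intro: reach_trans reach_sym)
  qed
next
  have "F \<subseteq> insert {a, b} F" "reach (insert {a, b} F) a b" "reach (insert {a, b} F) b a"
    by (auto intro: reach_edge simp: insert_commute)
  then show "?R v \<Longrightarrow> reach (insert {a, b} F) u v"
    by (meson reach_mono reach_trans)
qed

lemma connected_graph_reach:
  "connected_graph V F \<longleftrightarrow> V \<noteq> {} \<and> (\<forall>u\<in>V. \<forall>v\<in>V. reach F u v)"
  by (simp add: connected_graph_def reach_def)

lemma connected_graphI:
  assumes "r \<in> V" "\<And>v. v \<in> V \<Longrightarrow> reach F r v"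
  shows "connected_graph V F"
  using assms unfolding connected_graph_reach by (blast intro: reach_trans reach_sym)

lemma connected_graph_hom:
  assumes "connected_graph V F" "\<And>c d. {c, d} \<in> F \<Longrightarrow> reach W c d"
  shows "connected_graph V W"
  using assms(1) reach_hom[of F _ _ W "\<lambda>x. x"] assms(2) unfolding connected_graph_reach by blast

text \<open>Each edge merges at most two components, so at least |V| - |F| of them remain. Pairwise
  unreachable vertices represent them, and no set of components has to be tracked.\<close>

lemma exists_independent_set:
  assumes "finite F" "finite V" "\<And>e. e \<in> F \<Longrightarrow> card e = 2"
  shows "\<exists>R\<subseteq>V. card V \<le> card R + card F \<and> (\<forall>r\<in>R. \<forall>r'\<in>R. reach F r r' \<longrightarrow> r = r')"
  using assms(1,3)
proof (induction F rule: finite_induct)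
  case empty
  show ?case by (intro exI[of _ V]) auto
next
  case (insert e F)
  then obtain R where R: "R \<subseteq> V" "card V \<le> card R + card F"
    and ind: "\<And>r r'. r \<in> R \<Longrightarrow> r' \<in> R \<Longrightarrow> reach F r r' \<Longrightarrow> r = r'" by blast
  obtain a b where e: "e = {a, b}" using insert.prems[of e] by (auto simp: card_2_iff)
  have finR: "finite R" using R(1) assms(2) by (rule finite_subset)
  \<comment> \<open>By independence at most one member of \<open>R\<close> reaches \<open>a\<close>.
    Once it is dropped, \<open>{a, b}\<close> joins no two members of \<open>Q\<close>, since one of
    them would have to reach \<open>a\<close>.\<close>
  define Q where "Q = {r \<in> R. \<not> reach F r a}"
  have "r = r'" if "r \<in> R - Q" "r' \<in> R - Q" for r r'
    using that ind[of r r'] unfolding Q_def by (blast intro: reach_trans reach_sym)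
  then have "card (R - Q) \<le> 1"
    using finR by (simp add: card_le_Suc0_iff_eq)
  moreover have "card R = card Q + card (R - Q)"
    using finR by (subst card_Un_disjoint[symmetric]) (auto simp: Q_def intro: arg_cong[of _ _ card])
  ultimately have "card R \<le> card Q + 1" by simp
  moreover have "r = r'" if "r \<in> Q" "r' \<in> Q" "reach (insert e F) r r'" for r r'
    using that ind[of r r'] reach_sym[of F a r'] unfolding Q_def e reach_insert by blast
  ultimately show ?case
    using R insert.hyps by (intro exI[of _ Q]) (auto simp: Q_def)
qed

lemma connected_card_le:
  assumes "connected_graph V F" "finite F" "finite V" "\<And>e. e \<in> F \<Longrightarrow> card e = 2"
  shows "card V \<le> card F + 1"
proof -
  obtain R where R: "R \<subseteq> V" "card V \<le> card R + card F"
    "\<forall>r\<in>R. \<forall>r'\<in>R. reach F r r' \<longrightarrow> r = r'"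
    using exists_independent_set[of F V] assms(2,3,4) by meson
  have "r = r'" if "r \<in> R" "r' \<in> R" for r r'
    using that R(1,3) assms(1) unfolding connected_graph_reach by blast
  then have "card R \<le> 1"
    using R(1) assms(3) by (simp add: card_le_Suc0_iff_eq finite_subset)
  with R(2) show ?thesis by simp
qed

section \<open>Bridges, trees and split forests\<close>

text \<open>The component condition of \<open>is_split_subgraph\<close>, restated by reachability
  from the terminals.\<close>

definition splits :: "'a set \<Rightarrow> 'a \<Rightarrow> 'a \<Rightarrow> 'a set set \<Rightarrow> bool" where
  "splits V s t F \<longleftrightarrow> (\<forall>v\<in>V. reach F s v \<or> reach F t v) \<and> \<not> reach F s t"

text \<open>Acyclicity is encoded by the edge count, here and in \<open>forests\<close>, so cycles
  never appear; sums in place of differences avoid truncated subtraction.\<close>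

definition trees :: "'a set \<Rightarrow> 'a set set \<Rightarrow> 'a set set set" where
  "trees V E = {T. T \<subseteq> E \<and> connected_graph V T \<and> card T + 1 = card V}"

definition forests :: "'a set \<Rightarrow> 'a set set \<Rightarrow> 'a \<Rightarrow> 'a \<Rightarrow> 'a set set set" where
  "forests V E s t = {F. F \<subseteq> E \<and> splits V s t F \<and> card F + 2 = card V}"

text \<open>Only edges that separate \<open>s\<close> from \<open>t\<close> count; a cut edge with
  both terminals on one side does not.\<close>

definition bridges :: "'a set \<Rightarrow> 'a set set \<Rightarrow> 'a \<Rightarrow> 'a \<Rightarrow> 'a set set" where
  "bridges V E s t = {e \<in> E. splits V s t (E - {e})}"

lemma is_split_subgraph_iff:
  assumes "source G \<in> verts G" "sink G \<in> verts G"
  shows "is_split_subgraph G F \<longleftrightarrow> F \<subseteq> edges G \<and> splits (verts G) (source G) (sink G) F"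
proof -
  let ?V = "verts G" and ?s = "source G" and ?t = "sink G"
  define K where "K u = {v \<in> ?V. reach F u v}" for u
  have comps: "components_of_graph ?V F = K ` ?V"
    unfolding components_of_graph_def K_def reach_def by blast
  have K_eq: "K u = K v" if "reach F u v" for u v
    using that unfolding K_def by (blast intro: reach_trans reach_sym)
  have "(\<exists>A B. A \<noteq> B \<and> K ` ?V = {A, B} \<and> ?s \<in> A \<and> ?t \<in> B) \<longleftrightarrow> splits ?V ?s ?t F"
  proof
    assume "\<exists>A B. A \<noteq> B \<and> K ` ?V = {A, B} \<and> ?s \<in> A \<and> ?t \<in> B"
    then obtain A B where AB: "A \<noteq> B" "K ` ?V = {A, B}" "?s \<in> A" "?t \<in> B" by blast
    have K_mem: "K u = X" if "X \<in> K ` ?V" "u \<in> X" for u X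
      using that K_eq by (fastforce simp: K_def)
    have "K ?s = A" "K ?t = B" using K_mem AB by auto
    moreover have "K v = A \<or> K v = B" if "v \<in> ?V" for v using AB(2) that by blast
    moreover have "v \<in> K v" if "v \<in> ?V" for v using that by (simp add: K_def)
    ultimately show "splits ?V ?s ?t F"
      using K_eq AB(1) unfolding splits_def by (metis (mono_tags, lifting) K_def mem_Collect_eq)
  next
    assume sp: "splits ?V ?s ?t F"
    then have "K v = K ?s \<or> K v = K ?t" if "v \<in> ?V" for v
      using that K_eq unfolding splits_def by metis
    then have "K ` ?V = {K ?s, K ?t}" using assms by blast
    moreover have "K ?s \<noteq> K ?t"
      using sp assms unfolding splits_def K_def by auto
    ultimately show "\<exists>A B. A \<noteq> B \<and> K ` ?V = {A, B} \<and> ?s \<in> A \<and> ?t \<in> B"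
      using assms by (intro exI[of _ "K ?s"] exI[of _ "K ?t"]) (auto simp: K_def)
  qed
  then show ?thesis unfolding is_split_subgraph_def comps by simp
qed

section \<open>Passing between split and connected subgraphs\<close>

lemma splits_connected_insert:
  assumes "splits V s t F" "s \<in> V"
  shows "connected_graph V (insert {s, t} F)"
  using assms unfolding splits_def by (intro connected_graphI[of s]) (auto simp: reach_insert)

lemma splits_join:
  assumes "splits V s t F" "s \<in> V" "reach F s a" "reach F t b"
  shows "connected_graph V (insert {a, b} F)"
proof (rule connected_graphI[OF assms(2)])
  fix v assume "v \<in> V"
  then show "reach (insert {a, b} F) s v"
    using assms unfolding splits_def reach_insert by (meson reach_trans reach_sym)
qed

lemma connected_insert_splits:
  assumes "connected_graph V (insert {a, b} F)" "\<not> reach F s t" "s \<in> V" "t \<in> V"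
  shows "splits V s t F"
proof -
  have "\<And>v. v \<in> V \<Longrightarrow> reach (insert {a, b} F) s v"
    using assms(1,3) unfolding connected_graph_reach by blast
  from this[OF assms(4)] this show ?thesis
    using assms(2) unfolding splits_def reach_insert by (meson reach_trans reach_sym)
qed

locale terminal_graph =
  fixes V :: "'a set" and E :: "'a set set" and s t :: 'a
  assumes finV: "finite V"
    and edge: "\<And>e. e \<in> E \<Longrightarrow> e \<subseteq> V" "\<And>e. e \<in> E \<Longrightarrow> card e = 2"
    and conn: "connected_graph V E"
    and terminals: "s \<in> V" "t \<in> V" "s \<noteq> t"
begin

lemma finE: "finite E"
  using edge(1) finV by (meson Pow_iff finite_Pow_iff finite_subset subsetI)

lemma edgeE:
  assumes "e \<in> E"
  obtains a b where "e = {a, b}" "a \<noteq> b" "a \<in> V" "b \<in> V"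
proof -
  obtain a b where "e = {a, b}" "a \<noteq> b"
    using edge(2)[OF assms] by (auto simp: card_2_iff)
  with edge(1)[OF assms] that show thesis by blast
qed

lemma finite_sub: "F \<subseteq> E \<Longrightarrow> finite F"
  using finE finite_subset by blast

lemma finite_trees: "finite (trees V E)" and finite_forests: "finite (forests V E s t)"
  by (rule finite_subset[of _ "Pow E"]; auto simp: trees_def forests_def finE)+

lemma card_connected:
  assumes "F \<subseteq> E" "connected_graph V F"
  shows "card V \<le> card F + 1"
  using connected_card_le[OF assms(2) finite_sub[OF assms(1)] finV] edge(2) assms(1) by blast

text \<open>Separation of the terminals comes for free: if \<open>F\<close> joined \<open>s\<close>
  to \<open>t\<close>, then \<open>F\<close> itself would be connected, with only |V| - 2
  edges.\<close>

lemma forestI: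
  assumes "F \<subseteq> E" "card F + 2 = card V" "connected_graph V (insert {s, t} F)"
  shows "F \<in> forests V E s t"
proof -
  have "\<not> reach F s t"
  proof
    assume r: "reach F s t"
    have "connected_graph V F"
    proof (rule connected_graphI[OF terminals(1)])
      fix v assume "v \<in> V"
      then have "reach (insert {s, t} F) s v"
        using assms(3) terminals unfolding connected_graph_reach by blast
      with r show "reach F s v"
        unfolding reach_insert by (blast intro: reach_trans reach_sym)
    qed
    then show False using card_connected[OF assms(1)] assms(2) by simp
  qed
  then show ?thesis
    using connected_insert_splits[OF assms(3) _ terminals(1,2)] assms by (simp add: forests_def)
qed

text \<open>The tree grows from \<open>e\<close> by repeatedly adding an edge that leaves the vertex
  set covered so far.\<close>

lemma exists_tree_containing:
  assumes "e \<in> E"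
  shows "\<exists>T\<in>trees V E. e \<in> T"
proof -
  obtain a b where ab: "e = {a, b}" "a \<noteq> b" "a \<in> V" "b \<in> V" using edgeE[OF assms] .
  have "card {a, b} \<le> card V" using ab finV by (intro card_mono) auto
  then have two: "2 \<le> card V" using ab by simp
  have "\<exists>U F. U \<subseteq> V \<and> a \<in> U \<and> F \<subseteq> E \<and> \<Union>F \<subseteq> U \<and> e \<in> F \<and> card U = k \<and> card F + 1 = k \<and>
      (\<forall>u\<in>U. reach F a u)"
    if "2 \<le> k" "k \<le> card V" for k
    using that
  proof (induction k rule: nat_induct_at_least)
    case base
    show ?case
      using ab assms by (intro exI[of _ "{a, b}"] exI[of _ "{e}"]) (auto intro: reach_edge)
  next
    case (Suc k)
    then obtain U F where UF: "U \<subseteq> V" "a \<in> U" "F \<subseteq> E" "\<Union>F \<subseteq> U" "e \<in> F" "card U = k"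
      "card F + 1 = k" "\<forall>u\<in>U. reach F a u" by auto
    then have "U \<noteq> V" using Suc.prems by auto
    with UF(1) obtain w where w: "w \<in> V" "w \<notin> U" by blast
    then have "reach E a w"
      using conn ab unfolding connected_graph_reach by blast
    then obtain c d where cd: "c \<in> U" "d \<notin> U" "{c, d} \<in> E"
      using reach_crossing UF(2) w by metis
    have "{c, d} \<notin> F" using UF(4) cd by blast
    moreover have "finite F" "finite U"
      using UF(1,3) finite_sub finV finite_subset by auto
    moreover have "d \<in> V" using edge(1)[OF cd(3)] by simp
    ultimately show ?case
      using UF cd
      by (intro exI[of _ "insert d U"] exI[of _ "insert {c, d} F"])
        (auto simp: reach_insert)
  qed
  from this[OF two order_refl] obtain U F where
    UF: "U \<subseteq> V" "a \<in> U" "F \<subseteq> E" "e \<in> F" "card U = card V" "card F + 1 = card V"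
      "\<forall>u\<in>U. reach F a u" by blast
  then have "U = V" using finV card_subset_eq by blast
  with UF show ?thesis
    unfolding trees_def by (intro bexI[of _ F]) (auto intro: connected_graphI)
qed

section \<open>Exchanging edges between trees and split forests\<close>

lemma bridgesD:
  assumes "e \<in> bridges V E s t"
  shows "e \<in> E" "\<not> reach (E - {e}) s t" "splits V s t (E - {e})"
  using assms by (auto simp: bridges_def splits_def)

lemma treesD:
  assumes "R \<in> trees V E"
  shows "R \<subseteq> E" "connected_graph V R" "card R + 1 = card V" "finite R"
  using assms finite_sub by (auto simp: trees_def)

lemma forestsD:
  assumes "F \<in> forests V E s t"
  shows "F \<subseteq> E" "splits V s t F" "\<not> reach F s t" "card F + 2 = card V" "finite F"
  using assms finite_sub by (auto simp: forests_def splits_def)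

lemma tree_reach: "R \<in> trees V E \<Longrightarrow> u \<in> V \<Longrightarrow> v \<in> V \<Longrightarrow> reach R u v"
  using treesD(2) unfolding connected_graph_reach by blast

lemma card_tree_remove:
  assumes "R \<in> trees V E" "g \<in> R"
  shows "card (R - {g}) + 2 = card V"
  using treesD[OF assms(1)] card_Suc_Diff1[of R g] assms(2) by simp

lemma bridge_in_tree:
  assumes "e \<in> bridges V E s t" "R \<in> trees V E"
  shows "e \<in> R"
proof (rule ccontr)
  assume "e \<notin> R"
  then have "R \<subseteq> E - {e}" using treesD(1)[OF assms(2)] by blast
  then have "reach (E - {e}) s t"
    using reach_mono[OF tree_reach[OF assms(2) terminals(1,2)]] by simp
  then show False using bridgesD(2)[OF assms(1)] by blast
qed

lemma tree_remove_forest: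
  assumes "R \<in> trees V E" "g \<in> R" "\<not> reach (R - {g}) s t"
  shows "R - {g} \<in> forests V E s t"
proof -
  obtain a b where "g = {a, b}" using treesD(1)[OF assms(1)] assms(2) edgeE by blast
  moreover have "insert g (R - {g}) = R" using assms(2) by blast
  ultimately have "splits V s t (R - {g})"
    using connected_insert_splits[of V a b "R - {g}" s t] treesD(2)[OF assms(1)] assms(3) terminals
    by simp
  then show ?thesis
    using treesD(1)[OF assms(1)] card_tree_remove[OF assms(1,2)] by (auto simp: forests_def)
qed

lemma tree_remove_bridge:
  assumes "R \<in> trees V E" "g \<in> bridges V E s t"
  shows "R - {g} \<in> forests V E s t"
proof (rule tree_remove_forest[OF assms(1) bridge_in_tree[OF assms(2,1)]])
  have "R - {g} \<subseteq> E - {g}" using treesD(1)[OF assms(1)] by blast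
  then show "\<not> reach (R - {g}) s t"
    using reach_mono[of "R - {g}" s t "E - {g}"] bridgesD(2)[OF assms(2)] by metis
qed

lemma forest_insert_tree:
  assumes "F \<in> forests V E s t" "f \<in> E" "f \<notin> F" "connected_graph V (insert f F)"
  shows "insert f F \<in> trees V E"
  using forestsD[OF assms(1)] assms by (simp add: trees_def)

lemma bridge_ends:
  assumes "{a, b} \<in> bridges V E s t"
  shows "reach (E - {{a, b}}) s a \<and> reach (E - {{a, b}}) t b \<or>
    reach (E - {{a, b}}) s b \<and> reach (E - {{a, b}}) t a"
proof -
  have "insert {a, b} (E - {{a, b}}) = E" using bridgesD(1)[OF assms] by blast
  then have "reach (insert {a, b} (E - {{a, b}})) s t"
    using conn terminals unfolding connected_graph_reach by simp
  then show ?thesis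
    using bridgesD(2)[OF assms] unfolding reach_insert by (blast intro: reach_sym)
qed

text \<open>Already in \<open>E - {f}\<close> the ends of \<open>f\<close> lie on different sides.
  As \<open>F\<close> is a split subgraph of \<open>E - {f}\<close>, it separates them in the same
  way, and \<open>f\<close> joins its two parts.\<close>

lemma forest_insert_bridge:
  assumes "F \<in> forests V E s t" "f \<in> bridges V E s t" "f \<notin> F"
  shows "insert f F \<in> trees V E"
proof (rule forest_insert_tree[OF assms(1) bridgesD(1)[OF assms(2)] assms(3)])
  obtain a b where f: "f = {a, b}" "a \<in> V" "b \<in> V"
    using edgeE[OF bridgesD(1)[OF assms(2)]] by metis
  let ?E = "E - {f}"
  have sub: "F \<subseteq> ?E" using forestsD(1)[OF assms(1)] assms(3) by blast
  have sp: "splits V s t F" by (rule forestsD[OF assms(1)])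
  have mono: "reach F u v \<Longrightarrow> reach ?E u v" for u v using reach_mono[OF _ sub] .
  have "reach F s a \<or> reach F t a" "reach F s b \<or> reach F t b"
    using sp f unfolding splits_def by auto
  moreover have "reach ?E s a \<and> reach ?E t b \<or> reach ?E s b \<and> reach ?E t a"
    using bridge_ends assms(2) f(1) by blast
  ultimately have "reach F s a \<and> reach F t b \<or> reach F s b \<and> reach F t a"
    using bridgesD(2)[OF assms(2)] mono by (meson reach_sym reach_trans)
  then show "connected_graph V (insert f F)"
    using splits_join[OF sp terminals(1), of a b] splits_join[OF sp terminals(1), of b a] f(1)
    by (auto simp: insert_commute)
qed

lemma tree_remove_not_connected:
  assumes "R \<in> trees V E" "g \<in> R"
  shows "\<not> connected_graph V (R - {g})"
  using card_connected[of "R - {g}"] card_tree_remove[OF assms] treesD(1)[OF assms(1)] by auto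

lemma tree_remove_end_reach:
  assumes "R \<in> trees V E" "{c, d} \<in> R"
  shows "\<not> reach (R - {{c, d}}) c d"
proof
  let ?F = "R - {{c, d}}"
  assume cd: "reach ?F c d"
  have ins: "insert {c, d} ?F = R" using assms(2) by blast
  have "reach ?F s v" if "v \<in> V" for v
    using tree_reach[OF assms(1) terminals(1) that] cd reach_sym[OF cd]
      reach_insert[of c d ?F s v] unfolding ins by (blast intro: reach_trans)
  then have "connected_graph V ?F" by (rule connected_graphI[OF terminals(1)])
  then show False using tree_remove_not_connected[OF assms] by blast
qed

text \<open>The tree path from \<open>x\<close> to \<open>y\<close> does not stay inside
  \<open>Z\<close>. Without speaking of paths: if each single edge outside \<open>Z\<close> could be
  spared, all of them could be deleted one after another without separating \<open>x\<close> from
  \<open>y\<close>.\<close>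

lemma tree_cut_edge:
  assumes R: "R \<in> trees V E" and "Z \<subseteq> R" "x \<in> V" "y \<in> V" "\<not> reach Z x y"
  shows "\<exists>g\<in>R - Z. \<not> reach (R - {g}) x y"
proof (rule ccontr)
  assume "\<not> ?thesis"
  then have nocut: "reach (R - {g}) x y" if "g \<in> R - Z" for g using that by blast
  have "reach (R - X) x y" if "finite X" "X \<subseteq> R - Z" for X
    using that
  proof (induction X rule: finite_induct)
    case empty
    show ?case using tree_reach[OF R assms(3,4)] by simp
  next
    case (insert g X)
    obtain c d where g: "g = {c, d}" using insert.prems treesD(1)[OF R] edgeE by blast
    let ?F = "R - insert g X"
    have "R - X = insert {c, d} ?F" using insert.hyps insert.prems g by blast
    moreover have "reach (R - X) x y" using insert.IH insert.prems by blast
    ultimately have r: "reach (insert {c, d} ?F) x y" by simp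
    have sub: "?F \<subseteq> R - {g}" by blast
    have mono: "reach ?F u v \<Longrightarrow> reach (R - {g}) u v" for u v using reach_mono[OF _ sub] .
    have "\<not> reach (R - {g}) c d"
      using tree_remove_end_reach[OF R, of c d] insert.prems g by simp
    moreover have "reach (R - {g}) x y" using nocut insert.prems by blast
    ultimately show ?case
      using r mono unfolding reach_insert by (meson reach_sym reach_trans)
  qed
  from this[of "R - Z"] have "reach Z x y"
    using treesD(4)[OF R] assms(2) by (simp add: double_diff)
  with assms(5) show False by blast
qed

section \<open>Number of split forests in terms of trees and bridges\<close>

lemma bridges_subset_tree: "R \<in> trees V E \<Longrightarrow> bridges V E s t \<subseteq> R"
  using bridge_in_tree by blast

lemma finite_bridges: "finite (bridges V E s t)"
  using finE by (rule finite_subset[rotated]) (auto simp: bridges_def)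

text \<open>Every tree contains all of \<open>S\<close>, so \<open>g\<close> is the only element of
  \<open>S\<close> missing from \<open>R - {g}\<close>, and \<open>R\<close> is recovered by putting
  it back.\<close>

lemma inj_tree_remove_bridge:
  assumes "S \<subseteq> bridges V E s t"
  shows "inj_on (\<lambda>(R, g). R - {g}) (trees V E \<times> S)"
proof (rule inj_onI)
  fix p q assume p: "p \<in> trees V E \<times> S" and q: "q \<in> trees V E \<times> S"
    and eq: "(\<lambda>(R, g). R - {g}) p = (\<lambda>(R, g). R - {g}) q"
  obtain R g R' g' where pq: "p = (R, g)" "q = (R', g')" by fastforce
  have "S \<subseteq> R" "S \<subseteq> R'" "g \<in> S" "g' \<in> S"
    using p q subset_trans[OF assms bridges_subset_tree] unfolding pq by simp_all
  moreover have eq': "R - {g} = R' - {g'}" using eq unfolding pq by simp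
  ultimately have "g = g'" by blast
  moreover have "R = insert g (R - {g})" "R' = insert g' (R' - {g'})"
    using \<open>S \<subseteq> R\<close> \<open>S \<subseteq> R'\<close> \<open>g \<in> S\<close> \<open>g' \<in> S\<close> by blast+
  ultimately show "p = q" using eq' unfolding pq by metis
qed

lemma exists_forest_containing:
  assumes "R \<in> trees V E" "S \<subseteq> R" "\<not> reach S s t"
  shows "\<exists>g\<in>R - S. R - {g} \<in> forests V E s t"
  using tree_cut_edge[OF assms(1,2) terminals(1,2) assms(3)] tree_remove_forest[OF assms(1)] by blast

text \<open>Deleting a member of \<open>S\<close> from a tree gives
  \<open>card S * card (trees V E)\<close> forests, none of which contains \<open>S\<close>; the
  additional one does. A subset \<open>S\<close> suffices, so the bridges of a modified graph only
  have to be known in part.\<close>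

lemma card_forests_ge:
  assumes "S \<subseteq> bridges V E s t" "\<not> reach S s t" "trees V E \<noteq> {}"
  shows "card S * card (trees V E) + 1 \<le> card (forests V E s t)"
proof -
  obtain R where R: "R \<in> trees V E" using assms(3) by blast
  have "S \<subseteq> R" using assms(1) bridges_subset_tree[OF R] by blast
  then obtain g where g: "g \<in> R - S" "R - {g} \<in> forests V E s t"
    using exists_forest_containing[OF R _ assms(2)] by blast
  let ?A = "(\<lambda>(R, g). R - {g}) ` (trees V E \<times> S)"
  have A: "?A \<subseteq> forests V E s t" using tree_remove_bridge assms(1) by auto
  have "R - {g} \<notin> ?A" using g \<open>S \<subseteq> R\<close> by auto
  moreover have "card ?A = card S * card (trees V E)"
    using card_image[OF inj_tree_remove_bridge[OF assms(1)]] by (simp add: card_cartesian_product)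
  moreover have "finite ?A" using finite_subset[OF A finite_forests] .
  ultimately have "card S * card (trees V E) + 1 = card (insert (R - {g}) ?A)" by simp
  also have "\<dots> \<le> card (forests V E s t)"
    using A g finite_forests by (intro card_mono) auto
  finally show ?thesis .
qed

text \<open>Since the bridges join \<open>s\<close> to \<open>t\<close>, every split forest misses
  one of them, and adding it gives a tree.\<close>

lemma card_forests_le:
  assumes "reach (bridges V E s t) s t"
  shows "card (forests V E s t) \<le> card (bridges V E s t) * card (trees V E)"
proof -
  let ?B = "bridges V E s t"
  have "forests V E s t \<subseteq> (\<lambda>(R, g). R - {g}) ` (trees V E \<times> ?B)"
  proof
    fix F assume F: "F \<in> forests V E s t"
    then have "\<not> ?B \<subseteq> F" using reach_mono[OF assms] forestsD(3) by metis
    then obtain g where g: "g \<in> ?B" "g \<notin> F" by blast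
    then have "insert g F \<in> trees V E" "F = insert g F - {g}"
      using forest_insert_bridge[OF F] by auto
    then show "F \<in> (\<lambda>(R, g). R - {g}) ` (trees V E \<times> ?B)"
      using g by (intro image_eqI[of _ _ "(insert g F, g)"]) auto
  qed
  moreover have fin: "finite (trees V E \<times> ?B)" using finite_trees finite_bridges by simp
  ultimately have "card (forests V E s t) \<le> card ((\<lambda>(R, g). R - {g}) ` (trees V E \<times> ?B))"
    by (intro card_mono) auto
  also have "\<dots> \<le> card (trees V E \<times> ?B)" using fin by (rule card_image_le)
  finally show ?thesis by (simp add: card_cartesian_product mult.commute)
qed

text \<open>Spanning bridges would number at least |V| - 1. As |E| >= |V|, some edge is not a
  bridge; a tree through it contains all bridges as well and so has too many edges.\<close>

lemma bridges_not_spanning: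
  assumes "card V \<le> card E"
  shows "\<exists>v\<in>V. \<not> reach (bridges V E s t) s v"
proof (rule ccontr)
  let ?B = "bridges V E s t"
  assume "\<not> ?thesis"
  then have con: "connected_graph V ?B" using connected_graphI terminals(1) by metis
  have BE: "?B \<subseteq> E" by (auto simp: bridges_def)
  have "\<exists>e. e \<in> E" using terminals finV assms by (metis card_0_eq card.empty ex_in_conv le_zero_eq)
  then obtain R0 where R0: "R0 \<in> trees V E" using exists_tree_containing by blast
  have "card V \<le> card ?B + 1" using card_connected[OF BE con] .
  moreover have "card R0 < card E" using treesD(3)[OF R0] assms by simp
  moreover have "card ?B \<le> card R0"
    using bridges_subset_tree[OF R0] treesD(4)[OF R0] by (rule card_mono[rotated])
  ultimately have "?B \<noteq> E" by auto
  then obtain e where e: "e \<in> E" "e \<notin> ?B" using BE by blast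
  then obtain R where R: "R \<in> trees V E" "e \<in> R" using exists_tree_containing by blast
  have "insert e ?B \<subseteq> R" using R bridges_subset_tree by blast
  then have "card (insert e ?B) \<le> card R" using treesD(4)[OF R(1)] by (rule card_mono[rotated])
  then show False
    using e(2) finite_bridges \<open>card V \<le> card ?B + 1\<close> treesD(3)[OF R(1)] by simp
qed

section \<open>Moving a bridge\<close>

lemma bridgeI:
  assumes "g \<in> E" "\<not> reach (E - {g}) s t"
  shows "g \<in> bridges V E s t"
proof -
  obtain a b where g: "g = {a, b}" using edgeE[OF assms(1)] by metis
  have "insert {a, b} (E - {g}) = E" using assms(1) g by blast
  then have "splits V s t (E - {g})"
    using connected_insert_splits[of V a b "E - {g}" s t] conn assms(2) terminals by simp
  then show ?thesis using assms(1) by (simp add: bridges_def)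
qed

lemma bridge_ends_not_reach:
  assumes "{a, b} \<in> bridges V E s t"
  shows "\<not> reach (E - {{a, b}}) a b"
  using bridge_ends[OF assms] bridgesD(2)[OF assms] by (meson reach_sym reach_trans)

lemma trees_nonempty:
  assumes "card V \<le> card E"
  shows "trees V E \<noteq> {}"
proof -
  have "0 < card V" using terminals(1) finV card_gt_0_iff by blast
  then obtain e where "e \<in> E" using assms by (metis card.empty ex_in_conv not_le)
  then show ?thesis using exists_tree_containing by blast
qed

text \<open>If the bridges form a path from \<open>s\<close> to \<open>t\<close>, everything else hangs off this path.
  Moving one end of a bridge along a hanging edge keeps all trees and bridges, but makes room for
  a split forest containing every bridge.\<close>

lemma more_forests_by_moving_bridge:
  assumes st: "reach (bridges V E s t) s t" and mn: "card V \<le> card E"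
  shows "\<exists>E'. terminal_graph V E' s t \<and> card E' = card E \<and>
    card (forests V E s t) < card (forests V E' s t)"
proof -
  let ?B = "bridges V E s t"
  have BE: "?B \<subseteq> E" using bridgesD(1) by blast
  obtain v0 where v0: "v0 \<in> V" "\<not> reach ?B s v0" using bridges_not_spanning[OF mn] by blast
  then have "reach E s v0" using conn terminals unfolding connected_graph_reach by blast
  \<comment> \<open>\<open>u\<close> lies in the bridge component of the terminals and
    \<open>v\<close> outside it; \<open>{u, v}\<close> is the hanging edge along which a bridge is
    shifted.\<close>
  then obtain u v where u: "reach ?B s u" and v: "\<not> reach ?B s v" and uv: "{u, v} \<in> E"
    using reach_crossing[of E s v0 "Collect (reach ?B s)"] v0(2) by auto
  have "\<exists>z. z \<noteq> u \<and> reach ?B u z"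
    using terminals(3) reach_sym[OF u] reach_trans[OF reach_sym[OF u] st] by metis
  then obtain z where z: "z \<noteq> u" "reach ?B u z" by blast
  obtain w where w: "{u, w} \<in> ?B" "w \<noteq> u"
    using reach_crossing[OF z(2), of "{u}"] z(1) by auto
  define f where "f = {u, w}"
  define f' where "f' = {v, w}"
  have fB: "f \<in> ?B" and fE: "f \<in> E" using w(1) bridgesD(1) by (auto simp: f_def)
  have "reach ?B s w" using u reach_edge[OF w(1)] reach_trans by metis
  with u v have neq: "v \<noteq> u" "v \<noteq> w" by auto
  have uvB: "{u, v} \<notin> ?B" using u v reach_edge reach_trans by metis
  have uvf: "{u, v} \<in> E - {f}" using uv uvB fB by auto
  have nuw: "\<not> reach (E - {f}) u w" using bridge_ends_not_reach w(1) unfolding f_def by blast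
  have f'E: "f' \<notin> E"
  proof
    assume "f' \<in> E"
    then have "{v, w} \<in> E - {f}" using neq unfolding f'_def f_def by (auto simp: doubleton_eq_iff)
    then have "reach (E - {f}) u w" using reach_edge[OF uvf] reach_edge reach_trans by metis
    with nuw show False ..
  qed
  define E' where "E' = insert f' (E - {f})"
  \<comment> \<open>\<open>f'\<close> can be replaced by the walk v, u, w as long as
    \<open>{u, v}\<close> is kept. Hence the other bridges still separate the terminals.\<close>
  have swap: "reach (insert f Y) p q" if "reach (insert f' Y) p q" "{u, v} \<in> Y" for Y p q
  proof (rule reach_hom[OF that(1)])
    have "reach (insert f Y) w u" "reach (insert f Y) u v"
      using that(2) unfolding f_def by (auto intro: reach_edge simp: insert_commute)
    then have wv: "reach (insert f Y) w v" by (rule reach_trans)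
    fix c d assume "{c, d} \<in> insert f' Y"
    then have "{c, d} \<in> insert f Y \<or> c = v \<and> d = w \<or> c = w \<and> d = v"
      unfolding f'_def by (auto simp: doubleton_eq_iff)
    then show "reach (insert f Y) c d" using wv by (auto intro: reach_edge reach_sym)
  qed
  have conn': "connected_graph V (insert f' (Y - {f}))"
    if Y: "connected_graph V Y" "reach (Y - {f}) u v" for Y
  proof (rule connected_graph_hom[OF Y(1)])
    let ?Y = "insert f' (Y - {f})"
    have "reach ?Y u v" using Y(2) by (rule reach_mono) auto
    moreover have "reach ?Y v w" unfolding f'_def by (rule reach_edge) simp
    ultimately have uw: "reach ?Y u w" by (rule reach_trans)
    fix c d assume "{c, d} \<in> Y"
    then have "{c, d} \<in> ?Y \<or> c = u \<and> d = w \<or> c = w \<and> d = u"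
      unfolding f_def by (auto simp: doubleton_eq_iff)
    then show "reach ?Y c d" using uw by (auto intro: reach_edge reach_sym)
  qed
  have "u \<in> V" "v \<in> V" "w \<in> V" using edge(1)[OF uv] edge(1)[OF fE] unfolding f_def by auto
  interpret H: terminal_graph V E' s t
  proof
    show "connected_graph V E'"
      unfolding E'_def using conn' conn reach_edge[OF uvf] by blast
    show "e \<subseteq> V" "card e = 2" if "e \<in> E'" for e
      using that edge neq \<open>v \<in> V\<close> \<open>w \<in> V\<close> unfolding E'_def f'_def by auto
  qed (use finV terminals in auto)
  have cardE': "card E' = card E"
    using f'E fE finE card_Suc_Diff1[of E f] unfolding E'_def by simp
  define S where "S = insert f' (?B - {f})"
  have "f' \<notin> ?B" using f'E BE by blast
  then have cardS: "card S = card ?B"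
    using fB finite_bridges card_Suc_Diff1[of ?B f] unfolding S_def by simp
  have E'f': "E' - {f'} = E - {f}" unfolding E'_def using f'E by auto
  have SB: "S \<subseteq> bridges V E' s t"
  proof
    fix g assume g: "g \<in> S"
    show "g \<in> bridges V E' s t"
    proof (rule H.bridgeI)
      show "g \<in> E'" using g BE unfolding S_def E'_def by blast
      show "\<not> reach (E' - {g}) s t"
      proof (cases "g = f'")
        case True
        then show ?thesis using bridgesD(2)[OF fB] E'f' by simp
      next
        case False
        then have gB: "g \<in> ?B" "g \<noteq> f" using g unfolding S_def by auto
        then have "insert f (E - {f, g}) = E - {g}" using fE by blast
        moreover have "E' - {g} = insert f' (E - {f, g})" using False unfolding E'_def by auto
        moreover have "{u, v} \<in> E - {f, g}" using uvf uvB gB by auto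
        ultimately show ?thesis using swap[of "E - {f, g}" s t] bridgesD(2)[OF gB(1)] by auto
      qed
    qed
  qed
  \<comment> \<open>\<open>?B - {f}\<close> does not join \<open>s\<close> to \<open>t\<close>, and
    a connection through \<open>f'\<close> would reach \<open>v\<close> by old bridges
    alone.\<close>
  have nst: "\<not> reach S s t"
  proof
    have sub: "?B - {f} \<subseteq> E - {f}" "?B - {f} \<subseteq> ?B" using BE by auto
    have mono: "reach (?B - {f}) p q \<Longrightarrow> reach ?B p q" for p q using reach_mono[OF _ sub(2)] .
    have "\<not> reach (?B - {f}) s t" using bridgesD(2)[OF fB] reach_mono[OF _ sub(1)] by blast
    moreover assume "reach S s t"
    ultimately have "reach (?B - {f}) s v \<or> reach (?B - {f}) v t"
      unfolding S_def f'_def reach_insert by blast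
    then have "reach ?B s v \<or> reach ?B v t" using mono by blast
    then show False using v st by (meson reach_sym reach_trans)
  qed
  have "card (trees V E) \<le> card (trees V E')"
  proof (rule card_inj_on_le)
    show "inj_on (\<lambda>R. insert f' (R - {f})) (trees V E)"
    proof (rule inj_onI)
      fix R R' assume R: "R \<in> trees V E" "R' \<in> trees V E"
        and eq: "insert f' (R - {f}) = insert f' (R' - {f})"
      have "f \<in> R" "f' \<notin> R" "f \<in> R'" "f' \<notin> R'"
        using R bridge_in_tree[OF fB] treesD(1) f'E by blast+
      then have "R = insert f (insert f' (R - {f}) - {f'})" "R' = insert f (insert f' (R' - {f}) - {f'})"
        by auto
      with eq show "R = R'" by metis
    qed
    show "(\<lambda>R. insert f' (R - {f})) ` trees V E \<subseteq> trees V E'"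
    proof
      fix X assume "X \<in> (\<lambda>R. insert f' (R - {f})) ` trees V E"
      then obtain R where R: "R \<in> trees V E" "X = insert f' (R - {f})" by blast
      have fR: "f \<in> R" and f'R: "f' \<notin> R" using bridge_in_tree[OF fB R(1)] treesD(1)[OF R(1)] f'E by auto
      have ins: "insert {u, w} (R - {f}) = R" using fR unfolding f_def by blast
      have sub: "R - {f} \<subseteq> E - {f}" using treesD(1)[OF R(1)] by blast
      \<comment> \<open>Removing \<open>f\<close> from \<open>R\<close> leaves \<open>u\<close> and
        \<open>v\<close> on the same side, as they are adjacent in \<open>E - {f}\<close>; so
        \<open>f'\<close> reconnects the two parts.\<close>
      have "reach R u v" using tree_reach[OF R(1)] \<open>u \<in> V\<close> \<open>v \<in> V\<close> by blast
      then have "reach (R - {f}) u v \<or> reach (R - {f}) w v \<or> reach (R - {f}) u w"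
        using reach_insert[of u w "R - {f}" u v] unfolding ins by blast
      moreover have "\<not> reach (R - {f}) u w" using nuw reach_mono[OF _ sub] by blast
      moreover have "\<not> reach (R - {f}) w v"
        using nuw reach_mono[OF _ sub] reach_edge[OF uvf] by (meson reach_sym reach_trans)
      ultimately have "reach (R - {f}) u v" by blast
      then have "connected_graph V X" using conn'[OF treesD(2)[OF R(1)]] R(2) by simp
      moreover have "card X + 1 = card V"
        using treesD(3,4)[OF R(1)] fR f'R card_Suc_Diff1[of R f] unfolding R(2) by simp
      moreover have "X \<subseteq> E'" using treesD(1)[OF R(1)] unfolding R(2) E'_def by blast
      ultimately show "X \<in> trees V E'" by (simp add: trees_def)
    qed
  qed (rule H.finite_trees)
  then have "card ?B * card (trees V E) \<le> card S * card (trees V E')"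
    unfolding cardS by (rule mult_le_mono2)
  moreover have "card S * card (trees V E') + 1 \<le> card (forests V E' s t)"
    using H.card_forests_ge[OF SB nst] H.trees_nonempty mn cardE' by simp
  ultimately have "card (forests V E s t) < card (forests V E' s t)"
    using card_forests_le[OF st] by linarith
  then show ?thesis using H.terminal_graph_axioms cardE' by blast
qed

section \<open>Counting trees and split forests\<close>

text \<open>Otherwise the connection between \<open>x\<close> and \<open>x'\<close> within
  \<open>S\<close> contains a bridge \<open>j\<close>. Without \<open>j\<close>, \<open>s\<close>
  still reaches one of \<open>x\<close> and \<open>x'\<close> within \<open>S\<close>, and the edge
  there leads on to \<open>t\<close>, as the connections from \<open>y\<close> and \<open>y'\<close>
  to \<open>t\<close> lie in the other component of \<open>S\<close>. So \<open>j\<close> would not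
  separate the terminals.\<close>

lemma crossing_edge_unique_end:
  assumes S: "S \<subseteq> bridges V E s t" "\<not> reach S s t"
    and R: "R \<in> trees V E"
    and x: "reach S s x" "reach S s x'" "x \<in> V" "x' \<in> V"
    and y: "reach S y t" "reach S y' t"
    and xy: "{x, y} \<in> E - S" "{x', y'} \<in> E - S"
  shows "x = x'"
proof (rule ccontr)
  assume "x \<noteq> x'"
  then obtain j where j: "j \<in> R" "\<not> reach (R - {j}) x x'"
    using tree_cut_edge[OF R, of "{}" x x'] x by auto
  have SR: "S \<subseteq> R" using S(1) bridges_subset_tree[OF R] by blast
  have xx': "reach S x x'" using x(1,2) reach_sym reach_trans by metis
  have jS: "j \<in> S"
  proof (rule ccontr)
    assume "j \<notin> S"
    then have "S \<subseteq> R - {j}" using SR by blast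
    then show False using j(2) reach_mono[OF xx'] by blast
  qed
  define W where "W = S - {j}"
  have "W \<subseteq> R - {j}" using SR unfolding W_def by blast
  then have nW: "\<not> reach W x x'" using j(2) reach_mono by metis
  obtain c d where cd: "j = {c, d}" using j(1) treesD(1)[OF R] edgeE by blast
  have ins: "S = insert {c, d} W" using jS cd unfolding W_def by blast
  have WS: "reach S p q" if "reach W p q" for p q using that reach_mono[of W p q S] ins by blast
  have WE: "reach (E - {j}) p q" if "reach W p q" for p q
    using that reach_mono[of W p q "E - {j}"] S(1) bridgesD(1) unfolding W_def by blast
  have ends: "reach W x c \<and> reach W d x' \<or> reach W x d \<and> reach W c x'"
    using xx' nW unfolding ins reach_insert by blast
  have sW: "reach W s x \<or> reach W s x'"
    using x(1) ends unfolding ins reach_insert by (meson reach_sym reach_trans)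
  have Sc: "reach S s c" "reach S s d"
    using ends WS x(1,2) by (meson reach_sym reach_trans)+
  have yt: "reach W z t" if "reach S z t" for z
  proof (rule ccontr)
    assume "\<not> reach W z t"
    then have "reach W c t \<or> reach W d t" using that unfolding ins reach_insert by blast
    then show False using Sc WS S(2) by (meson reach_trans)
  qed
  have "reach (E - {j}) x y" "reach (E - {j}) x' y'"
    using xy jS by (auto intro!: reach_edge)
  then have "reach (E - {j}) s t"
    using sW yt[OF y(1)] yt[OF y(2)] WE by (meson reach_trans)
  then show False using bridgesD(2) jS S(1) by blast
qed

lemma swap_terminals: "terminal_graph V E t s"
  using finV edge conn terminals by unfold_locales auto

lemma bridges_swap: "bridges V E t s = bridges V E s t"
  unfolding bridges_def splits_def by (blast intro: reach_sym)

text \<open>By the preceding lemma, applied at each terminal, both edges have the same ends; a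
  simple graph has no parallel edges.\<close>

lemma crossing_edge_unique:
  assumes S: "S \<subseteq> bridges V E s t" "\<not> reach S s t"
    and R: "R \<in> trees V E"
    and gh: "g \<in> E - S" "h \<in> E - S" "reach (insert g S) s t" "reach (insert h S) s t"
  shows "g = h"
proof -
  have ends: "\<exists>x y. g = {x, y} \<and> x \<in> V \<and> y \<in> V \<and> reach S s x \<and> reach S y t"
    if "g \<in> E - S" "reach (insert g S) s t" for g
  proof -
    from that(1) obtain a b where "g = {a, b}" "a \<in> V" "b \<in> V" using edgeE by blast
    with that(2) S(2) show ?thesis unfolding reach_insert by (metis insert_commute reach_insert)
  qed
  obtain x y where x: "g = {x, y}" "x \<in> V" "y \<in> V" "reach S s x" "reach S y t"
    using ends gh by blast
  obtain x' y' where x': "h = {x', y'}" "x' \<in> V" "y' \<in> V" "reach S s x'" "reach S y' t"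
    using ends gh by blast
  interpret sw: terminal_graph V E t s by (rule swap_terminals)
  have "x = x'"
    using crossing_edge_unique_end[OF S R, of x x' y y'] x x' gh by blast
  moreover have "y = y'"
    using sw.crossing_edge_unique_end[of S R y y' x x'] bridges_swap S R x x' gh
    by (metis insert_commute reach_sym)
  ultimately show ?thesis using x x' by simp
qed

text \<open>These are the split forests that no tree yields by deleting a bridge; they supply the
  surplus in the averaging.\<close>

abbreviation (input) full_forests where
  "full_forests \<equiv> {F \<in> forests V E s t. bridges V E s t \<subseteq> F}"

text \<open>Every tree has an edge whose removal gives a split forest containing all bridges. The inequality
  is strict, as equality would yield two parallel edges.\<close>

lemma card_trees_less:
  assumes nst: "\<not> reach (bridges V E s t) s t" and mn: "card V \<le> card E"
  shows "card (trees V E) < card full_forests * (card E - card V + 2)"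
proof -
  let ?B = "bridges V E s t"
  have "\<exists>g. g \<in> R - ?B \<and> R - {g} \<in> forests V E s t" if "R \<in> trees V E" for R
    using exists_forest_containing[OF that bridges_subset_tree[OF that] nst] by blast
  then obtain \<gamma> where \<gamma>: "\<And>R. R \<in> trees V E \<Longrightarrow> \<gamma> R \<in> R - ?B"
    "\<And>R. R \<in> trees V E \<Longrightarrow> R - {\<gamma> R} \<in> forests V E s t" by metis
  \<comment> \<open>A tree is encoded by a full forest and the edge that restores it; each forest
    leaves \<open>card E - card V + 2\<close> edges to choose from.\<close>
  let ?\<phi> = "\<lambda>R. (R - {\<gamma> R}, \<gamma> R)"
  let ?P = "Sigma full_forests (\<lambda>F. E - F)"
  have restore: "insert (\<gamma> R) (R - {\<gamma> R}) = R" if "R \<in> trees V E" for R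
    using \<gamma>(1)[OF that] by blast
  have sub: "?\<phi> ` trees V E \<subseteq> ?P"
  proof
    fix p assume "p \<in> ?\<phi> ` trees V E"
    then obtain R where R: "R \<in> trees V E" "p = ?\<phi> R" by blast
    then show "p \<in> ?P"
      using \<gamma>[OF R(1)] bridges_subset_tree[OF R(1)] treesD(1)[OF R(1)] by auto
  qed
  have inj: "inj_on ?\<phi> (trees V E)"
    by (rule inj_onI) (metis restore prod.inject)
  have finP: "finite ?P"
    using finite_forests finE by (intro finite_SigmaI) auto
  have cardEF: "card (E - F) = card E - card V + 2" if "F \<in> forests V E s t" for F
    using forestsD[OF that] mn by (simp add: card_Diff_subset)
  then have "card ?P = (\<Sum>F\<in>full_forests. card E - card V + 2)"
    using finite_forests finE by (subst card_SigmaI) auto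
  then have cardP: "card ?P = card full_forests * (card E - card V + 2)" by simp
  \<comment> \<open>In case of equality, each of the at least two edges outside a full forest
    \<open>F\<close> would complete the bridges to a connection of \<open>s\<close> and
    \<open>t\<close>, contrary to \<open>crossing_edge_unique\<close>.\<close>
  have "?\<phi> ` trees V E \<noteq> ?P"
  proof
    assume eq: "?\<phi> ` trees V E = ?P"
    obtain R0 where R0: "R0 \<in> trees V E" using trees_nonempty[OF mn] by blast
    define F where "F = R0 - {\<gamma> R0}"
    have F: "F \<in> full_forests" using sub R0 unfolding F_def by blast
    have reach_h: "reach (insert h ?B) s t" if h: "h \<in> E - F" for h
    proof -
      have "(F, h) \<in> ?\<phi> ` trees V E" using eq F h by blast
      then obtain R where R: "R \<in> trees V E" "F = R - {\<gamma> R}" "h = \<gamma> R" by blast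
      \<comment> \<open>Cutting \<open>R\<close> at another such edge \<open>g\<close> would give a
        second pair that restores \<open>R\<close>, but \<open>\<gamma>\<close> picks only one edge
        per tree.\<close>
      have "reach (R - {g}) s t" if g: "g \<in> R - insert h ?B" for g
      proof (rule ccontr)
        assume "\<not> reach (R - {g}) s t"
        then have "R - {g} \<in> full_forests"
          using tree_remove_forest[OF R(1)] bridges_subset_tree[OF R(1)] g by blast
        then have "(R - {g}, g) \<in> ?\<phi> ` trees V E"
          unfolding eq using g treesD(1)[OF R(1)] by blast
        then obtain R' where R': "R' \<in> trees V E" "R - {g} = R' - {\<gamma> R'}" "g = \<gamma> R'" by blast
        have "R' = R" using restore[OF R'(1)] R'(2,3) g by auto
        then show False using R'(3) R(3) g by blast
      qed
      moreover have "insert h ?B \<subseteq> R"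
        using bridges_subset_tree[OF R(1)] \<gamma>(1)[OF R(1)] R(3) by blast
      ultimately show ?thesis using tree_cut_edge[OF R(1) _ terminals(1,2)] by blast
    qed
    have "\<not> card (E - F) \<le> Suc 0" using cardEF F by simp
    then obtain g h where gh: "g \<in> E - F" "h \<in> E - F" "g \<noteq> h"
      using card_le_Suc0_iff_eq[of "E - F"] finE by blast
    then have "g = h"
      using crossing_edge_unique[OF order_refl nst R0, of g h] reach_h F by blast
    then show False using gh(3) by blast
  qed
  then have "card (?\<phi> ` trees V E) < card ?P"
    using sub finP by (intro psubset_card_mono) auto
  then show ?thesis using card_image[OF inj] cardP by simp
qed

text \<open>Averaging over all edges \<open>e\<close> that are not bridges.\<close>

lemma exists_edge_with_many_forests:
  assumes nst: "\<not> reach (bridges V E s t) s t" and mn: "card V \<le> card E"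
    and f: "f \<in> bridges V E s t"
    and arith: "card E - card (bridges V E s t) \<le>
      (card (bridges V E s t) - 1) * (card E - card V + 1) + 1"
  shows "\<exists>e\<in>E - bridges V E s t. card {F \<in> forests V E s t. f \<notin> F} <
    card {F \<in> forests V E s t. f \<in> F \<and> e \<notin> F}"
proof (rule ccontr)
  let ?B = "bridges V E s t" and ?\<tau> = "card (trees V E)" and ?m = "card E - card V + 1"
  define A where "A = {F \<in> forests V E s t. f \<in> F}"
  have finA: "finite A" using finite_forests unfolding A_def by simp
  have tau: "card {F \<in> forests V E s t. f \<notin> F} \<le> ?\<tau>"
  proof (rule card_inj_on_le)
    show "inj_on (insert f) {F \<in> forests V E s t. f \<notin> F}"
      by (rule inj_onI) (metis (mono_tags, lifting) insert_ident mem_Collect_eq)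
    show "insert f ` {F \<in> forests V E s t. f \<notin> F} \<subseteq> trees V E"
      using forest_insert_bridge f by blast
  qed (rule finite_trees)
  assume neg: "\<not> ?thesis"
  have le: "card {F \<in> A. e \<notin> F} \<le> ?\<tau>" if "e \<in> E - ?B" for e
  proof -
    have "{F \<in> forests V E s t. f \<in> F \<and> e \<notin> F} = {F \<in> A. e \<notin> F}"
      unfolding A_def by blast
    moreover have "\<not> card {F \<in> forests V E s t. f \<notin> F} <
        card {F \<in> forests V E s t. f \<in> F \<and> e \<notin> F}"
      by (rule notI, rule notE[OF neg], rule bexI[OF _ that])
    ultimately have "card {F \<in> A. e \<notin> F} \<le> card {F \<in> forests V E s t. f \<notin> F}"
      by simp
    then show ?thesis using tau by (rule order_trans)
  qed
  have BE: "?B \<subseteq> E" using bridgesD(1) by blast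
  \<comment> \<open>Double counting of the pairs of a forest in \<open>A\<close> and an edge outside
    it that is not a bridge.\<close>
  have "(\<Sum>F\<in>A. card (E - ?B - F)) = (\<Sum>F\<in>A. \<Sum>e\<in>E - ?B. if e \<notin> F then 1 else 0)"
    using finE by (intro sum.cong) (auto simp: sum.If_cases Int_def set_diff_eq intro: arg_cong[of _ _ card])
  also have "\<dots> = (\<Sum>e\<in>E - ?B. \<Sum>F\<in>A. if e \<notin> F then 1 else 0)" by (rule sum.swap)
  also have "\<dots> = (\<Sum>e\<in>E - ?B. card {F \<in> A. e \<notin> F})"
    using finA by (intro sum.cong) (auto simp: sum.If_cases Int_def)
  also have "\<dots> \<le> (\<Sum>e\<in>E - ?B. ?\<tau>)" using le by (rule sum_mono)
  also have "\<dots> = (card E - card ?B) * ?\<tau>"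
    using BE finite_bridges by (simp add: card_Diff_subset)
  finally have upper: "(\<Sum>F\<in>A. card (E - ?B - F)) \<le> (card E - card ?B) * ?\<tau>" .
  define A1 where "A1 = (\<lambda>(R, g). R - {g}) ` (trees V E \<times> (?B - {f}))"
  have A1: "A1 \<subseteq> A"
    using tree_remove_bridge bridge_in_tree[OF f] unfolding A1_def A_def by auto
  have "card A1 = ?\<tau> * (card ?B - 1)"
    unfolding A1_def using card_image[OF inj_tree_remove_bridge[of "?B - {f}"]] f finite_bridges
    by (simp add: card_cartesian_product)
  have low1: "?m \<le> card (E - ?B - F)" if F: "F \<in> A1" for F
  proof -
    obtain R g where R: "R \<in> trees V E" "g \<in> ?B" "F = R - {g}"
      using F unfolding A1_def by auto
    have "E - R \<subseteq> E - ?B - F" using bridges_subset_tree[OF R(1)] R(3) by blast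
    then have "card (E - R) \<le> card (E - ?B - F)" using finE by (intro card_mono) auto
    moreover have "card (E - R) = ?m"
      using treesD[OF R(1)] mn by (simp add: card_Diff_subset)
    ultimately show ?thesis by simp
  qed
  have low2: "?m + 1 \<le> card (E - ?B - F)" if "F \<in> full_forests" for F
  proof -
    have "E - ?B - F = E - F" using that by blast
    moreover have "card (E - F) = ?m + 1"
      using that forestsD[of F] mn by (simp add: card_Diff_subset)
    ultimately show ?thesis by simp
  qed
  have disj: "A1 \<inter> full_forests = {}" unfolding A1_def by auto
  have D: "full_forests \<subseteq> A" using f unfolding A_def by blast
  have "?\<tau> * (card ?B - 1) * ?m + card full_forests * (?m + 1) =
      (\<Sum>F\<in>A1. ?m) + (\<Sum>F\<in>full_forests. ?m + 1)"
    using \<open>card A1 = _\<close> by simp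
  also have "\<dots> \<le> (\<Sum>F\<in>A1. card (E - ?B - F)) + (\<Sum>F\<in>full_forests. card (E - ?B - F))"
    using low1 low2 by (intro add_mono sum_mono) auto
  also have "\<dots> = (\<Sum>F\<in>A1 \<union> full_forests. card (E - ?B - F))"
    using finite_subset[OF A1 finA] finite_subset[OF D finA] disj by (simp add: sum.union_disjoint)
  also have "\<dots> \<le> (\<Sum>F\<in>A. card (E - ?B - F))"
    using A1 D finA by (intro sum_mono2) auto
  also note upper
  finally have "?\<tau> * (card ?B - 1) * ?m + card full_forests * (?m + 1) \<le> (card E - card ?B) * ?\<tau>" .
  moreover have "?\<tau> < card full_forests * (?m + 1)"
    using card_trees_less[OF nst mn] by simp
  moreover have "(card E - card ?B) * ?\<tau> \<le> ((card ?B - 1) * ?m + 1) * ?\<tau>"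
    using arith by (rule mult_le_mono1)
  ultimately show False by (simp add: algebra_simps)
qed

section \<open>Contracting a bridge\<close>

text \<open>Removing another bridge would leave the edge \<open>{s, t}\<close> in place. Thus
  contracting \<open>f\<close> does not identify the terminals.\<close>

lemma terminals_not_bridge:
  assumes "f \<in> bridges V E s t" "2 \<le> card (bridges V E s t)"
  shows "f \<noteq> {s, t}"
proof
  assume f: "f = {s, t}"
  have "\<not> bridges V E s t \<subseteq> {f}"
    using assms(2) card_mono[of "{f}" "bridges V E s t"] by auto
  then obtain j where j: "j \<in> bridges V E s t" "j \<noteq> f" by blast
  then have "reach (E - {j}) s t"
    using bridgesD(1)[OF assms(1)] f by (intro reach_edge) blast
  then show False using bridgesD(2)[OF j(1)] by blast
qed

text \<open>The bridge \<open>f = {a, b}\<close> is contracted to \<open>a\<close>, and the freed vertex \<open>b\<close> subdivides \<open>e\<close>; the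
  bijection \<open>\<psi>\<close> on edges reuses \<open>e\<close> and \<open>f\<close> as the two halves of the subdivided edge.\<close>

lemma contract_bridge_subdivide_edge:
  assumes f: "f \<in> bridges V E s t" and e: "e \<in> E - bridges V E s t"
    and two: "2 \<le> card (bridges V E s t)"
  shows "\<exists>E' s' t'. terminal_graph V E' s' t' \<and> card E' = card E \<and>
    card {F \<in> forests V E s t. f \<in> F} + card {F \<in> forests V E s t. f \<in> F \<and> e \<notin> F} \<le>
      card (forests V E' s' t')"
proof -
  have fE: "f \<in> E" and eE: "e \<in> E" and ef: "e \<noteq> f" using f e bridgesD(1) by auto
  obtain a b where ab: "f = {a, b}" "a \<noteq> b" "a \<in> V" "b \<in> V" using edgeE[OF fE] .
  obtain x y where xy: "e = {x, y}" "x \<noteq> y" "x \<in> V" "y \<in> V" using edgeE[OF eE] .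
  define \<phi> where "\<phi> z = (if z = b then a else z)" for z
  define \<psi> where "\<psi> g = (if g = e then {\<phi> x, b} else if g = f then {\<phi> y, b} else \<phi> ` g)" for g
  have \<phi>V: "\<phi> z \<in> V" if "z \<in> V" for z using that ab unfolding \<phi>_def by simp
  have \<phi>b: "\<phi> z \<noteq> b" for z using ab(2) unfolding \<phi>_def by simp
  have \<phi>eq: "\<phi> c = \<phi> d \<longleftrightarrow> c = d \<or> {c, d} = f" for c d
    unfolding \<phi>_def ab(1) by (auto simp: doubleton_eq_iff)
  have \<phi>xy: "\<phi> x \<noteq> \<phi> y" using \<phi>eq xy ef by simp
  \<comment> \<open>A bridge lies in no triangle, so contracting it creates no parallel edges and
    the edge count is kept.\<close>
  have no_triangle: False if "{a, z} \<in> E" "{b, z} \<in> E" "z \<noteq> a" "z \<noteq> b" for z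
  proof -
    have "{a, z} \<in> E - {f}" "{z, b} \<in> E - {f}"
      using that ab(1,2) by (auto simp: doubleton_eq_iff insert_commute)
    then have "reach (E - {f}) a b" using reach_edge reach_trans by metis
    then show False using bridge_ends_not_reach f ab(1) by blast
  qed
  have \<phi>image: "g = g'" if g: "g \<in> E" "g \<noteq> f" and g': "g' \<in> E" "g' \<noteq> f"
    and eq: "\<phi> ` g = \<phi> ` g'" for g g'
  proof -
    have form: "b \<notin> h \<and> \<phi> ` h = h \<or> (\<exists>z. h = {b, z} \<and> z \<noteq> a \<and> z \<noteq> b \<and> \<phi> ` h = {a, z})"
      if h: "h \<in> E" "h \<noteq> f" for h
    proof (cases "b \<in> h")
      case True
      obtain p q where "h = {p, q}" "p \<noteq> q" using edgeE[OF h(1)] .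
      then obtain z where "h = {b, z}" "z \<noteq> b" using True by auto
      then show ?thesis using h(2) ab(1) unfolding \<phi>_def by (auto simp: insert_commute)
    next
      case False
      then show ?thesis unfolding \<phi>_def by force
    qed
    from form[OF g] form[OF g'] show ?thesis
    proof (elim disjE conjE exE)
      assume "\<phi> ` g = g" "\<phi> ` g' = g'"
      with eq show ?thesis by simp
    next
      fix z assume "\<phi> ` g = g" "g' = {b, z}" "z \<noteq> a" "z \<noteq> b" "\<phi> ` g' = {a, z}"
      then show ?thesis using no_triangle[of z] g g' eq by simp
    next
      fix z assume "\<phi> ` g' = g'" "g = {b, z}" "z \<noteq> a" "z \<noteq> b" "\<phi> ` g = {a, z}"
      then show ?thesis using no_triangle[of z] g g' eq by simp
    next
      fix z z' assume "g = {b, z}" "\<phi> ` g = {a, z}" "g' = {b, z'}" "\<phi> ` g' = {a, z'}"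
      with eq show ?thesis by (auto simp: doubleton_eq_iff)
    qed
  qed
  have b_image: "b \<notin> \<phi> ` g" for g using \<phi>b by blast
  have inj: "inj_on \<psi> E"
  proof (rule inj_onI)
    fix g g' assume g: "g \<in> E" "g' \<in> E" and eq: "\<psi> g = \<psi> g'"
    have "b \<in> \<psi> h \<longleftrightarrow> h = e \<or> h = f" for h using b_image unfolding \<psi>_def by simp
    with eq have "g = e \<or> g = f \<longleftrightarrow> g' = e \<or> g' = f" by blast
    moreover have "\<psi> e \<noteq> \<psi> f"
      using \<phi>xy \<phi>b ef unfolding \<psi>_def by (auto simp: doubleton_eq_iff)
    ultimately show "g = g'"
      using eq \<phi>image[of g g'] g unfolding \<psi>_def by (auto split: if_splits)
  qed
  define E' where "E' = \<psi> ` E"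
  \<comment> \<open>\<open>W\<close> joins the images of the ends of every edge of \<open>F\<close>
    except the collapsed \<open>f\<close>; the freed vertex \<open>b\<close> is not in the image of
    \<open>\<phi>\<close> and needs an edge of its own, at \<open>z\<close>.\<close>
  have contract: "connected_graph V W"
    if F: "connected_graph V F" and W: "\<And>c d. {c, d} \<in> F \<Longrightarrow> {c, d} \<noteq> f \<Longrightarrow> reach W (\<phi> c) (\<phi> d)"
      and z: "z \<in> V" "z \<noteq> b" "{z, b} \<in> W" for F W z
  proof (rule connected_graphI[OF ab(3)])
    have r: "reach W a v" if v: "v \<in> V" "v \<noteq> b" for v
    proof -
      have "reach W (\<phi> a) (\<phi> v)"
      proof (rule reach_hom[where h = \<phi>])
        show "reach F a v" using F ab v unfolding connected_graph_reach by blast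
        show "reach W (\<phi> c) (\<phi> d)" if "{c, d} \<in> F" for c d
          using W[OF that] \<phi>eq[of c d] by (cases "{c, d} = f") auto
      qed
      then show ?thesis using v(2) unfolding \<phi>_def by simp
    qed
    have "reach W a b" using reach_trans[OF r[OF z(1,2)] reach_edge[OF z(3)]] .
    then show "reach W a v" if "v \<in> V" for v using r[OF that] by (cases "v = b") auto
  qed
  have \<psi>_other: "\<psi> {c, d} = {\<phi> c, \<phi> d}" if "{c, d} \<noteq> e" "{c, d} \<noteq> f" for c d
    using that unfolding \<psi>_def by simp
  have \<psi>_e: "\<psi> e = {\<phi> x, b}" and \<psi>_f: "\<psi> f = {\<phi> y, b}" using ef unfolding \<psi>_def by auto
  \<comment> \<open>If \<open>e\<close> lies in \<open>F\<close>, it becomes a walk along two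
    halves, one of which is \<open>\<psi> f\<close>; this is why \<open>f \<in> F\<close> is
    assumed.\<close>
  have through: "reach W (\<phi> c) (\<phi> d)"
    if "{c, d} \<in> F" "{c, d} \<noteq> f" "f \<in> F" "\<psi> ` F \<subseteq> W" for c d F W
  proof (cases "{c, d} = e")
    case True
    then have "{\<phi> x, b} \<in> W" "{\<phi> y, b} \<in> W" using that \<psi>_e \<psi>_f by blast+
    then have "reach W (\<phi> x) (\<phi> y)" using reach_edge reach_sym reach_trans by metis
    then show ?thesis using True xy(1) by (auto simp: doubleton_eq_iff intro: reach_sym)
  next
    case False
    then have "{\<phi> c, \<phi> d} \<in> W" using that \<psi>_other[of c d] by blast
    then show ?thesis by (rule reach_edge)
  qed
  have st: "\<phi> s \<noteq> \<phi> t" using \<phi>eq terminals(3) terminals_not_bridge[OF f two] by metis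
  interpret H: terminal_graph V E' "\<phi> s" "\<phi> t"
  proof
    fix h assume "h \<in> E'"
    then obtain g where g: "g \<in> E" "h = \<psi> g" unfolding E'_def by blast
    obtain c d where cd: "g = {c, d}" "c \<noteq> d" "c \<in> V" "d \<in> V" using edgeE[OF g(1)] .
    have "h = {\<phi> x, b} \<or> h = {\<phi> y, b} \<or> h = {\<phi> c, \<phi> d} \<and> \<phi> c \<noteq> \<phi> d"
      using g(2) cd \<phi>eq[of c d] unfolding \<psi>_def by auto
    then show "h \<subseteq> V" "card h = 2" using \<phi>V xy ab cd \<phi>b by auto
  next
    show "connected_graph V E'"
      unfolding E'_def
    proof (rule contract[OF conn])
      show "{\<phi> y, b} \<in> \<psi> ` E" using \<psi>_f fE by blast
    qed (use through[of _ _ E] fE \<phi>V xy \<phi>b in auto)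
  qed (use finV \<phi>V terminals st in auto)
  have cardE': "card E' = card E" unfolding E'_def by (rule card_image[OF inj])
  have inj_image: "\<psi> ` F = \<psi> ` F' \<longleftrightarrow> F = F'" if "F \<subseteq> E" "F' \<subseteq> E" for F F'
    using inj_on_image_eq_iff[OF inj that] .
  have card_image: "card (\<psi> ` F) = card F" if "F \<subseteq> E" for F
    using card_image inj_on_subset[OF inj that] by blast
  define A1 where "A1 = {F \<in> forests V E s t. f \<in> F}"
  define A2 where "A2 = {F \<in> forests V E s t. f \<in> F \<and> e \<notin> F}"
  \<comment> \<open>If \<open>e\<close> is not in \<open>F\<close>, the image of \<open>F\<close>
    under \<open>\<psi>\<close> has \<open>b\<close> hanging on \<open>\<phi> y\<close>. Exchanging
    \<open>f\<close> for \<open>e\<close> beforehand lets \<open>b\<close> hang on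
    \<open>\<phi> x\<close> instead, which gives a second forest.\<close>
  define sub where "sub F = insert e (F - {f})" for F
  have M1: "\<psi> ` F \<in> forests V E' (\<phi> s) (\<phi> t)" if "F \<in> A1" for F
  proof (rule H.forestI)
    have F: "F \<in> forests V E s t" "f \<in> F" using that unfolding A1_def by auto
    show "\<psi> ` F \<subseteq> E'" "card (\<psi> ` F) + 2 = card V"
      using forestsD[OF F(1)] card_image unfolding E'_def by auto
    show "connected_graph V (insert {\<phi> s, \<phi> t} (\<psi> ` F))"
    proof (rule contract[OF splits_connected_insert[OF forestsD(2)[OF F(1)] terminals(1)]])
      fix c d assume cd: "{c, d} \<in> insert {s, t} F" "{c, d} \<noteq> f"
      show "reach (insert {\<phi> s, \<phi> t} (\<psi> ` F)) (\<phi> c) (\<phi> d)"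
      proof (cases "{c, d} \<in> F")
        case True
        then show ?thesis using through[OF _ cd(2) F(2)] by blast
      next
        case False
        then have "{\<phi> c, \<phi> d} = {\<phi> s, \<phi> t}" using cd(1) by (auto simp: doubleton_eq_iff)
        then show ?thesis by (intro reach_edge) simp
      qed
    next
      show "{\<phi> y, b} \<in> insert {\<phi> s, \<phi> t} (\<psi> ` F)" using \<psi>_f F(2) by blast
    qed (use \<phi>V xy \<phi>b in auto)
  qed
  have M2: "\<psi> ` sub F \<in> forests V E' (\<phi> s) (\<phi> t)" if "F \<in> A2" for F
  proof (rule H.forestI)
    have F: "F \<in> forests V E s t" "f \<in> F" "e \<notin> F" using that unfolding A2_def by auto
    have subE: "sub F \<subseteq> E" using forestsD(1)[OF F(1)] eE unfolding sub_def by blast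
    have "card (sub F) = card F"
      using F forestsD(5)[OF F(1)] card_Suc_Diff1[of F f] unfolding sub_def by simp
    then show "\<psi> ` sub F \<subseteq> E'" "card (\<psi> ` sub F) + 2 = card V"
      using subE forestsD(4)[OF F(1)] card_image[OF subE] unfolding E'_def by auto
    show "connected_graph V (insert {\<phi> s, \<phi> t} (\<psi> ` sub F))"
    proof (rule contract[OF splits_connected_insert[OF forestsD(2)[OF F(1)] terminals(1)]])
      fix c d assume cd: "{c, d} \<in> insert {s, t} F" "{c, d} \<noteq> f"
      have "{\<phi> c, \<phi> d} \<in> insert {\<phi> s, \<phi> t} (\<psi> ` sub F)"
      proof (cases "{c, d} \<in> F")
        case True
        then have "{c, d} \<in> sub F" "{c, d} \<noteq> e" using cd(2) F(3) unfolding sub_def by auto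
        then show ?thesis using \<psi>_other[OF _ cd(2)] by (metis imageI insertCI)
      next
        case False
        then show ?thesis using cd(1) by (auto simp: doubleton_eq_iff)
      qed
      then show "reach (insert {\<phi> s, \<phi> t} (\<psi> ` sub F)) (\<phi> c) (\<phi> d)" by (rule reach_edge)
    next
      show "{\<phi> x, b} \<in> insert {\<phi> s, \<phi> t} (\<psi> ` sub F)" using \<psi>_e unfolding sub_def by blast
    qed (use \<phi>V xy \<phi>b in auto)
  qed
  have A1E: "F \<subseteq> E" "f \<in> F" if "F \<in> A1" for F using that forestsD(1) unfolding A1_def by auto
  have A2E: "sub F \<subseteq> E" "f \<notin> sub F" "insert f (sub F - {e}) = F" if "F \<in> A2" for F
  proof -
    have F: "F \<subseteq> E" "f \<in> F" "e \<notin> F" using that forestsD(1) unfolding A2_def by auto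
    then show "sub F \<subseteq> E" "f \<notin> sub F" "insert f (sub F - {e}) = F"
      using eE ef unfolding sub_def by auto
  qed
  have fin: "finite A1" "finite A2" using finite_forests unfolding A1_def A2_def by auto
  have "inj_on ((`) \<psi>) A1"
    by (rule inj_onI) (simp only: inj_image[OF A1E(1) A1E(1)])
  then have c1: "card ((`) \<psi> ` A1) = card A1" by (rule Finite_Set.card_image)
  have "inj_on (\<lambda>F. \<psi> ` sub F) A2"
  proof (rule inj_onI)
    fix F F' assume F: "F \<in> A2" "F' \<in> A2" "\<psi> ` sub F = \<psi> ` sub F'"
    then have "sub F = sub F'" using inj_image[OF A2E(1)[OF F(1)] A2E(1)[OF F(2)]] by simp
    then show "F = F'" using A2E(3)[OF F(1)] A2E(3)[OF F(2)] by metis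
  qed
  then have c2: "card ((\<lambda>F. \<psi> ` sub F) ` A2) = card A2" by (rule Finite_Set.card_image)
  have disj: "(`) \<psi> ` A1 \<inter> (\<lambda>F. \<psi> ` sub F) ` A2 = {}"
  proof -
    have "\<psi> ` F \<noteq> \<psi> ` sub F'" if "F \<in> A1" "F' \<in> A2" for F F'
      using inj_image[OF A1E(1)[OF that(1)] A2E(1)[OF that(2)]] A1E(2)[OF that(1)] A2E(2)[OF that(2)]
      by blast
    then show ?thesis by blast
  qed
  have "card A1 + card A2 = card ((`) \<psi> ` A1 \<union> (\<lambda>F. \<psi> ` sub F) ` A2)"
    using c1 c2 disj fin by (simp add: card_Un_disjoint)
  also have "\<dots> \<le> card (forests V E' (\<phi> s) (\<phi> t))"
    using M1 M2 by (intro card_mono[OF H.finite_forests]) blast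
  finally show ?thesis
    using H.terminal_graph_axioms cardE' unfolding A1_def A2_def by blast
qed

lemma more_forests:
  assumes two: "2 \<le> card (bridges V E s t)" and mn: "card V \<le> card E"
    and arith: "card E - card (bridges V E s t) \<le>
      (card (bridges V E s t) - 1) * (card E - card V + 1) + 1"
  shows "\<exists>E' s' t'. terminal_graph V E' s' t' \<and> card E' = card E \<and>
    card (forests V E s t) < card (forests V E' s' t')"
proof (cases "reach (bridges V E s t) s t")
  case True
  then show ?thesis using more_forests_by_moving_bridge mn by blast
next
  case False
  have "bridges V E s t \<noteq> {}" using two by auto
  then obtain f where f: "f \<in> bridges V E s t" by (meson ex_in_conv)
  obtain e where e: "e \<in> E - bridges V E s t"
    and less: "card {F \<in> forests V E s t. f \<notin> F} < card {F \<in> forests V E s t. f \<in> F \<and> e \<notin> F}"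
    using exists_edge_with_many_forests[OF False mn f arith] by blast
  have "card (forests V E s t) =
      card ({F \<in> forests V E s t. f \<in> F} \<union> {F \<in> forests V E s t. f \<notin> F})"
    by (rule arg_cong[of _ _ card]) blast
  also have "\<dots> = card {F \<in> forests V E s t. f \<in> F} + card {F \<in> forests V E s t. f \<notin> F}"
    using finite_forests by (intro card_Un_disjoint) auto
  finally have "card (forests V E s t) <
      card {F \<in> forests V E s t. f \<in> F} + card {F \<in> forests V E s t. f \<in> F \<and> e \<notin> F}"
    using less by linarith
  moreover obtain E' s' t' where "terminal_graph V E' s' t'" "card E' = card E"
    "card {F \<in> forests V E s t. f \<in> F} + card {F \<in> forests V E s t. f \<in> F \<and> e \<notin> F} \<le>
      card (forests V E' s' t')"
    using contract_bridge_subdivide_edge[OF f e two] by (elim exE conjE)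
  ultimately show ?thesis
    by (intro exI[of _ E'] exI[of _ s'] exI[of _ t'] conjI) (assumption | linarith)+
qed

end

section \<open>Asymptotics of the split reliability\<close>

lemma is_two_terminal_graph_iff:
  "is_two_terminal_graph G \<longleftrightarrow> terminal_graph (verts G) (edges G) (source G) (sink G)"
  unfolding is_two_terminal_graph_def simple_graph_def terminal_graph_def by blast

definition split_sets :: "'a set \<Rightarrow> 'a set set \<Rightarrow> 'a \<Rightarrow> 'a \<Rightarrow> 'a set set set" where
  "split_sets V E s t = {F. F \<subseteq> E \<and> splits V s t F}"

lemma split_reliability_sum:
  assumes "is_two_terminal_graph G" "0 \<le> p" "p \<le> 1"
  shows "split_reliability G p =
    (\<Sum>F\<in>split_sets (verts G) (edges G) (source G) (sink G).
      p ^ card F * (1 - p) ^ (card (edges G) - card F))"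
proof -
  interpret terminal_graph "verts G" "edges G" "source G" "sink G"
    using assms(1) by (simp add: is_two_terminal_graph_iff)
  let ?E = "edges G"
  define \<S> where "\<S> = split_sets (verts G) ?E (source G) (sink G)"
  define M where "M = Pi_pmf ?E False (\<lambda>_. bernoulli_pmf p)"
  define ind where "ind F e \<longleftrightarrow> e \<in> F" for F and e :: "'a set"
  have sub: "F \<subseteq> ?E" if "F \<in> \<S>" for F using that by (simp add: \<S>_def split_sets_def)
  have fin: "finite \<S>" by (rule finite_subset[of _ "Pow ?E"]) (use sub finE in auto)
  have split: "is_split_subgraph G F \<longleftrightarrow> F \<in> \<S>" for F
    using is_split_subgraph_iff terminals unfolding \<S>_def split_sets_def by blast
  \<comment> \<open>The event also contains functions that are \<open>True\<close> outside
    \<open>?E\<close>. They have probability 0 because the default value is \<open>False\<close>, so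
    only indicator functions of members of \<open>\<S>\<close> count.\<close>
  have "split_reliability G p = measure_pmf.prob M (ind ` \<S>)"
    unfolding split_reliability_def M_def[symmetric]
  proof (rule measure_prob_cong_0)
    fix x assume "x \<in> {x. is_split_subgraph G {e \<in> ?E. x e}} - ind ` \<S>"
    then have x: "{e \<in> ?E. x e} \<in> \<S>" "x \<notin> ind ` \<S>" using split by auto
    have "ind {e \<in> ?E. x e} \<noteq> x" using x(2) imageI[OF x(1), of ind] by metis
    then obtain e where "ind {e \<in> ?E. x e} e \<noteq> x e" by blast
    then have "e \<notin> ?E" "x e" unfolding ind_def by auto
    then show "pmf M x = 0" unfolding M_def by (intro pmf_Pi_outside[OF finE]) auto
  next
    fix x assume "x \<in> ind ` \<S> - {x. is_split_subgraph G {e \<in> ?E. x e}}"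
    then obtain F where F: "F \<in> \<S>" "x = ind F" "{e \<in> ?E. x e} \<notin> \<S>" using split by auto
    then have "{e \<in> ?E. x e} = F" using sub[OF F(1)] unfolding ind_def by auto
    then show "pmf M x = 0" using F by simp
  qed
  also have "\<dots> = (\<Sum>x\<in>ind ` \<S>. pmf M x)"
    using fin by (intro measure_measure_pmf_finite) simp
  also have "\<dots> = (\<Sum>F\<in>\<S>. pmf M (ind F))"
  proof (rule sum.reindex_cong[OF _ refl refl])
    show "inj_on ind \<S>"
    proof (rule inj_onI)
      fix F F' assume "ind F = ind F'"
      then have "{e. ind F e} = {e. ind F' e}" by simp
      then show "F = F'" unfolding ind_def by simp
    qed
  qed
  also have "\<dots> = (\<Sum>F\<in>\<S>. p ^ card F * (1 - p) ^ (card ?E - card F))"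
  proof (rule sum.cong[OF refl])
    fix F assume F: "F \<in> \<S>"
    note FE = sub[OF F]
    have "pmf M (ind F) = (\<Prod>e\<in>?E. if e \<in> F then p else 1 - p)"
      unfolding M_def using FE assms(2,3)
      by (subst pmf_Pi'[OF finE]) (auto simp: ind_def intro!: prod.cong)
    also have "\<dots> = (\<Prod>e\<in>F. p) * (\<Prod>e\<in>?E - F. 1 - p)"
      using FE finE by (simp add: prod.If_cases Int_absorb1 Diff_eq)
    also have "\<dots> = p ^ card F * (1 - p) ^ (card ?E - card F)"
      using FE finE finite_sub by (simp add: card_Diff_subset)
    finally show "pmf M (ind F) = p ^ card F * (1 - p) ^ (card ?E - card F)" .
  qed
  finally show ?thesis unfolding \<S>_def .
qed

text \<open>At p = 0 a term equals 1 if \<open>u i = k\<close>, because 0^0 = 1, and vanishes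
  otherwise; the rest is continuity.\<close>

lemma tendsto_lowest_order:
  fixes u z :: "'b \<Rightarrow> nat"
  assumes "finite I" "\<And>i. i \<in> I \<Longrightarrow> k \<le> u i"
  shows "((\<lambda>p::real. \<Sum>i\<in>I. p ^ (u i - k) * (1 - p) ^ z i) \<longlongrightarrow> real (card {i \<in> I. u i = k}))
    (at_right 0)"
proof -
  let ?g = "\<lambda>p::real. \<Sum>i\<in>I. p ^ (u i - k) * (1 - p) ^ z i"
  have "?g 0 = (\<Sum>i\<in>I. if u i = k then 1 else 0)"
    using assms(2) by (intro sum.cong) (auto simp: power_0_left le_antisym)
  also have "\<dots> = real (card {i \<in> I. u i = k})"
    using assms(1) by (simp add: sum.If_cases Int_def)
  finally have "?g 0 = real (card {i \<in> I. u i = k})" .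
  moreover have "(?g \<longlongrightarrow> ?g 0) (at_right 0)"
    by (intro tendsto_intros)
  ultimately show ?thesis by simp
qed

lemma sum_factor_lowest_order:
  fixes u z :: "'b \<Rightarrow> nat" and p :: real
  assumes "\<And>i. i \<in> I \<Longrightarrow> k \<le> u i"
  shows "(\<Sum>i\<in>I. p ^ u i * (1 - p) ^ z i) = p ^ k * (\<Sum>i\<in>I. p ^ (u i - k) * (1 - p) ^ z i)"
  unfolding sum_distrib_left
  using assms by (intro sum.cong) (auto simp: power_add[symmetric] mult.assoc[symmetric])

text \<open>Divide by p^k and let p tend to 0. The exponents \<open>w\<close> and \<open>v\<close>
  are independent parameters, so that p and 1 - p can exchange roles for the limit at the other
  end.\<close>

lemma card_lowest_order_le:
  fixes w v :: "'b \<Rightarrow> nat" and w' v' :: "'c \<Rightarrow> nat"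
  assumes fin: "finite I" "finite J"
    and k: "\<And>i. i \<in> I \<Longrightarrow> k \<le> w i" "\<And>j. j \<in> J \<Longrightarrow> k \<le> w' j"
    and le: "\<And>p::real. 0 < p \<Longrightarrow> p < 1 \<Longrightarrow>
      (\<Sum>i\<in>I. p ^ w i * (1 - p) ^ v i) \<le> (\<Sum>j\<in>J. p ^ w' j * (1 - p) ^ v' j)"
  shows "card {i \<in> I. w i = k} \<le> card {j \<in> J. w' j = k}"
proof -
  have "(\<Sum>i\<in>I. p ^ (w i - k) * (1 - p) ^ v i) \<le> (\<Sum>j\<in>J. p ^ (w' j - k) * (1 - p) ^ v' j)"
    if p: "0 < p" "p < 1" for p :: real
  proof -
    have "p ^ k * (\<Sum>i\<in>I. p ^ (w i - k) * (1 - p) ^ v i) \<le>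
        p ^ k * (\<Sum>j\<in>J. p ^ (w' j - k) * (1 - p) ^ v' j)"
      using le[OF p] sum_factor_lowest_order[of I k w p v] sum_factor_lowest_order[of J k w' p v'] k
      by simp
    then show ?thesis using p by simp
  qed
  then have "\<forall>\<^sub>F p in at_right (0::real).
      (\<Sum>i\<in>I. p ^ (w i - k) * (1 - p) ^ v i) \<le> (\<Sum>j\<in>J. p ^ (w' j - k) * (1 - p) ^ v' j)"
    by (auto simp: eventually_at_right_field intro!: exI[of _ 1])
  note tendsto_le[OF trivial_limit_at_right_real tendsto_lowest_order[OF fin(2) k(2), where z = v']
      tendsto_lowest_order[OF fin(1) k(1), where z = v] this]
  then show ?thesis by simp
qed

section \<open>Lowest-order coefficients at both ends of the interval\<close>

context terminal_graph
begin

lemma finite_split_sets: "finite (split_sets V E s t)"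
  by (rule finite_subset[of _ "Pow E"]) (auto simp: split_sets_def finE)

lemma split_sets_card_ge:
  assumes "F \<in> split_sets V E s t"
  shows "card V - 2 \<le> card F"
proof -
  have F: "F \<subseteq> E" "splits V s t F" using assms by (auto simp: split_sets_def)
  have "card e = 2" if "e \<in> insert {s, t} F" for e
    using that terminals(3) edge(2) F(1) by auto
  then have "card V \<le> card (insert {s, t} F) + 1"
    using connected_card_le[OF splits_connected_insert[OF F(2) terminals(1)] _ finV]
      finite_sub[OF F(1)] by simp
  also have "card (insert {s, t} F) \<le> card F + 1" by (simp add: card_insert_le_m1 finite_sub[OF F(1)] card_insert_if)
  finally show ?thesis by simp
qed

lemma split_sets_card_less:
  assumes "F \<in> split_sets V E s t"
  shows "card F < card E"
proof -
  have "F \<subseteq> E" "F \<noteq> E"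
    using assms conn terminals unfolding split_sets_def splits_def connected_graph_reach by auto
  then show ?thesis using finE by (intro psubset_card_mono) auto
qed

lemma two_le_card_V: "2 \<le> card V"
proof -
  have "card {s, t} \<le> card V" using terminals finV by (intro card_mono) auto
  then show ?thesis using terminals(3) by simp
qed

lemma forests_eq: "forests V E s t = {F \<in> split_sets V E s t. card F = card V - 2}"
  using two_le_card_V unfolding forests_def split_sets_def by auto

text \<open>The right side is the coefficient of lowest order in 1 - p: the one edge missing from
  such a split subgraph is a bridge.\<close>

lemma card_bridges_eq:
  "card (bridges V E s t) = card {F \<in> split_sets V E s t. card E - card F = 1}"
proof (rule bij_betw_same_card)
  show "bij_betw (\<lambda>e. E - {e}) (bridges V E s t) {F \<in> split_sets V E s t. card E - card F = 1}"
    unfolding bij_betw_def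
  proof
    show "inj_on (\<lambda>e. E - {e}) (bridges V E s t)"
      by (rule inj_onI) (auto simp: bridges_def)
    show "(\<lambda>e. E - {e}) ` bridges V E s t = {F \<in> split_sets V E s t. card E - card F = 1}"
    proof (intro equalityI subsetI)
      fix F assume "F \<in> (\<lambda>e. E - {e}) ` bridges V E s t"
      then obtain e where e: "e \<in> E" "splits V s t (E - {e})" "F = E - {e}"
        unfolding bridges_def by blast
      have "card F + 1 = card E" using card_Suc_Diff1[OF finE e(1)] e(3) by simp
      then show "F \<in> {F \<in> split_sets V E s t. card E - card F = 1}"
        using e unfolding split_sets_def by auto
    next
      fix F assume "F \<in> {F \<in> split_sets V E s t. card E - card F = 1}"
      then have F: "F \<subseteq> E" "splits V s t F" "card (E - F) = 1"
        using finite_sub by (auto simp: split_sets_def card_Diff_subset)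
      then obtain e where "E - F = {e}" by (auto simp: card_1_singleton_iff)
      then have "e \<in> E" "F = E - {e}" using F(1) by auto
      then show "F \<in> (\<lambda>e. E - {e}) ` bridges V E s t"
        using F(2) unfolding bridges_def by blast
    qed
  qed
qed

end

lemma card_le_of_split_reliability_le:
  assumes G: "is_two_terminal_graph G" and H: "is_two_terminal_graph H"
    and n: "card (verts H) = card (verts G)" and m: "card (edges H) = card (edges G)"
    and le: "\<And>p. p \<in> {0..1} \<Longrightarrow> split_reliability H p \<le> split_reliability G p"
  shows "card (forests (verts H) (edges H) (source H) (sink H)) \<le>
      card (forests (verts G) (edges G) (source G) (sink G))"
    and "card (bridges (verts H) (edges H) (source H) (sink H)) \<le>
      card (bridges (verts G) (edges G) (source G) (sink G))"
proof -
  interpret G: terminal_graph "verts G" "edges G" "source G" "sink G"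
    using G by (simp add: is_two_terminal_graph_iff)
  interpret H: terminal_graph "verts H" "edges H" "source H" "sink H"
    using H by (simp add: is_two_terminal_graph_iff)
  let ?G = "split_sets (verts G) (edges G) (source G) (sink G)"
  let ?H = "split_sets (verts H) (edges H) (source H) (sink H)"
  let ?n = "card (verts G)" and ?m = "card (edges G)"
  have sum_le: "(\<Sum>F\<in>?H. p ^ card F * (1 - p) ^ (?m - card F)) \<le>
      (\<Sum>F\<in>?G. p ^ card F * (1 - p) ^ (?m - card F))" if "0 < p" "p < 1" for p :: real
    using le[of p] that split_reliability_sum[OF G, of p] split_reliability_sum[OF H, of p] m by simp
  show "card (forests (verts H) (edges H) (source H) (sink H)) \<le>
      card (forests (verts G) (edges G) (source G) (sink G))"
    unfolding G.forests_eq H.forests_eq n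
  proof (rule card_lowest_order_le)
    show "?n - 2 \<le> card F" if "F \<in> ?H" for F using H.split_sets_card_ge[OF that] n by simp
  qed (use H.finite_split_sets G.finite_split_sets G.split_sets_card_ge sum_le in auto)
  show "card (bridges (verts H) (edges H) (source H) (sink H)) \<le>
      card (bridges (verts G) (edges G) (source G) (sink G))"
    unfolding G.card_bridges_eq H.card_bridges_eq m
  proof (rule card_lowest_order_le)
    show "1 \<le> ?m - card F" if "F \<in> ?H" for F using H.split_sets_card_less[OF that] m by simp
    show "1 \<le> ?m - card F" if "F \<in> ?G" for F using G.split_sets_card_less[OF that] by simp
    \<comment> \<open>Near p = 1 the deletion probability is the small quantity, so the comparison
      is used at 1 - p.\<close>
    show "(\<Sum>F\<in>?H. p ^ (?m - card F) * (1 - p) ^ card F) \<le>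
      (\<Sum>F\<in>?G. p ^ (?m - card F) * (1 - p) ^ card F)" if "0 < p" "p < 1" for p :: real
      using sum_le[of "1 - p"] that by (simp add: mult.commute)
  qed (use H.finite_split_sets G.finite_split_sets in auto)
qed

section \<open>Graphs with many bridges\<close>

text \<open>The path 0, ..., c is attached to a complete graph on c, ..., n - 1, with terminals 0
  and n - 1. \<open>E\<close> is chosen between the Hamiltonian path \<open>P\<close>, which keeps
  it connected, and the set \<open>P0 \<union> Q\<close> of all these edges.\<close>

lemma exists_graph_with_bridges:
  fixes n m c :: nat
  assumes c: "c + 2 \<le> n" and mn: "n \<le> m + 1" and m: "m \<le> ((n - c) choose 2) + c"
  shows "\<exists>E. terminal_graph {..<n} E 0 (n - 1) \<and> card E = m \<and>
    c \<le> card (bridges {..<n} E 0 (n - 1))"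
proof -
  define e where "e i = {i, Suc i}" for i :: nat
  have inj: "inj_on e X" for X unfolding e_def by (rule inj_onI) (auto simp: doubleton_eq_iff)
  define P where "P = e ` {..<n - 1}"
  define Q where "Q = {d. d \<subseteq> {c..<n} \<and> card d = 2}"
  define P0 where "P0 = e ` {..<c}"
  have finQ: "finite Q" unfolding Q_def by (rule finite_subset[of _ "Pow {c..<n}"]) auto
  have disj: "P0 \<inter> Q = {}" unfolding P0_def Q_def e_def by auto
  have "card (P0 \<union> Q) = c + ((n - c) choose 2)"
    using card_Un_disjoint[OF _ finQ disj] card_image[OF inj, of "{..<c}"] n_subsets[of "{c..<n}" 2]
    unfolding Q_def P0_def by simp
  moreover have PQ: "P \<subseteq> P0 \<union> Q"
  proof
    fix d assume "d \<in> P"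
    then obtain i where i: "i < n - 1" "d = {i, Suc i}" unfolding P_def e_def by blast
    show "d \<in> P0 \<union> Q"
    proof (cases "i < c")
      case True
      then show ?thesis using i unfolding P0_def e_def by blast
    next
      case False
      then have "d \<in> Q" using i unfolding Q_def by auto
      then show ?thesis by blast
    qed
  qed
  moreover have "card P \<le> m" unfolding P_def using mn by (simp add: card_image[OF inj])
  ultimately obtain E where E: "P \<subseteq> E" "E \<subseteq> P0 \<union> Q" "card E = m"
    using exists_subset_between[of P m "P0 \<union> Q"] m mn finQ unfolding P0_def by auto
  have path: "reach F i j" if "i \<le> j" "\<And>l. i \<le> l \<Longrightarrow> l < j \<Longrightarrow> e l \<in> F" for F i j
    using that
  proof (induction j rule: dec_induct)
    case (step l)
    then have "reach F i l" "reach F l (Suc l)"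
      unfolding e_def by (auto intro: reach_edge)
    then show ?case by (rule reach_trans)
  qed simp
  interpret terminal_graph "{..<n}" E 0 "n - 1"
  proof
    fix d assume "d \<in> E"
    then consider i where "i < c" "d = {i, Suc i}" | "d \<subseteq> {c..<n}" "card d = 2"
      using E(2) unfolding P0_def Q_def e_def by blast
    then show "d \<subseteq> {..<n}" "card d = 2"
      using c by (cases; fastforce)+
  next
    show "connected_graph {..<n} E"
    proof (rule connected_graphI)
      show "reach E 0 v" if "v \<in> {..<n}" for v
        using that E(1) unfolding P_def by (intro path) auto
    qed (use c in auto)
  qed (use c in auto)
  have "P0 \<subseteq> bridges {..<n} E 0 (n - 1)"
  proof
    fix d assume "d \<in> P0"
    then obtain i where i: "i < c" "d = e i" unfolding P0_def by blast
    show "d \<in> bridges {..<n} E 0 (n - 1)"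
    proof (rule bridgeI)
      show "d \<in> E" using E(1) i c unfolding P_def by auto
      show "\<not> reach (E - {d}) 0 (n - 1)"
      proof
        assume r: "reach (E - {d}) 0 (n - 1)"
        \<comment> \<open>Only \<open>e i\<close> leaves \<open>{..i}\<close>: edges of
          \<open>Q\<close> have no end below \<open>c\<close>.\<close>
        have "0 \<in> {..i}" "n - 1 \<notin> {..i}" using i c by auto
        then obtain a b where "a \<in> {..i}" "b \<notin> {..i}" "{a, b} \<in> E - {d}"
          by (rule reach_crossing[OF r])
        then have ab: "a \<le> i" "i < b" "{a, b} \<in> E - {d}" by simp_all
        then have "{a, b} \<in> P0" using E(2) i(1) unfolding Q_def by auto
        then obtain j where "{a, b} = {j, Suc j}" unfolding P0_def e_def by blast
        then have "{a, b} = d" using ab(1,2) i(2) unfolding e_def by (auto simp: doubleton_eq_iff)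
        with ab(3) show False by simp
      qed
    qed
  qed
  then have "card P0 \<le> card (bridges {..<n} E 0 (n - 1))"
    using finite_bridges by (rule card_mono[rotated])
  then show ?thesis
    using terminal_graph_axioms E(3) card_image[OF inj, of "{..<c}"] unfolding P0_def by auto
qed

text \<open>As b - 1 >= 2, it suffices that 2n <= m + b + 3. For n <= b + 2 this follows from n <=
  m. Otherwise \<open>max\<close>, which says that m is too large for the construction with b + 1
  bridges, bounds m from below quadratically in n - b.\<close>

lemma bridge_count_arith:
  fixes n m b :: nat
  assumes b: "3 \<le> b" and mn: "n \<le> m"
    and max: "b + 3 \<le> n \<Longrightarrow> ((n - (b + 1)) choose 2) + (b + 1) < m"
  shows "m - b \<le> (b - 1) * (m - n + 1) + 1"
proof -
  obtain k where m: "m = n + k" using mn le_Suc_ex by blast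
  define X where "X = (b - 1) * (m - n + 1)"
  have "2 * (m - n + 1) \<le> X" unfolding X_def using b by (intro mult_le_mono1) simp
  then have two: "2 * k + 2 \<le> X" using m by simp
  have "m - b \<le> X + 1"
  proof (cases "b + 3 \<le> n")
    case False
    then show ?thesis using two m by linarith
  next
    case True
    define K where "K = n - b - 3"
    have n: "n = K + b + 3" using True unfolding K_def by simp
    have "(Suc (Suc K) choose 2) = (Suc (Suc K)) * Suc K div 2" by (simp add: choose_two)
    moreover have "even (Suc (Suc K) * Suc K)" by simp
    ultimately have "2 * (Suc (Suc K) choose 2) = Suc (Suc K) * Suc K" by simp
    moreover have "n - (b + 1) = Suc (Suc K)" using n by simp
    then have "(Suc (Suc K) choose 2) + (b + 1) < m" using max[OF True] by simp
    ultimately have "Suc (Suc K) * Suc K + 2 * b + 4 \<le> 2 * m" by linarith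
    \<comment> \<open>This amounts to K <= K^2, with equality for K = 0 and K = 1.\<close>
    moreover have "4 * K + 4 \<le> Suc (Suc K) * Suc K + 2"
      by (cases K) (auto simp: algebra_simps)
    ultimately have "2 * K + b + 3 \<le> m" by linarith
    then show ?thesis using two m n by linarith
  qed
  then show ?thesis unfolding X_def .
qed

theorem theorem2:
  fixes n m :: nat
  assumes "7 \<le> n" and "n \<le> m" and "m \<le> ((n - 3) choose 2) + 3"
  shows "\<not> (\<exists>C \<in> T n m. uniformly_most_split_reliable n m C)"
proof
  assume "\<exists>C \<in> T n m. uniformly_most_split_reliable n m C"
  then obtain C where C: "C \<in> T n m" "uniformly_most_split_reliable n m C" by blast
  have refl: "(G, G) \<in> iso_rel" if "is_two_terminal_graph G" for G
    using that isomorphic_refl by (simp add: iso_rel_def)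
  obtain G where G: "G \<in> two_terminal_graphs n m" "G \<in> C"
  proof -
    obtain G where "G \<in> two_terminal_graphs n m" "C = iso_rel `` {G}"
      using C(1) unfolding T_def by (rule quotientE)
    then show thesis using that refl unfolding two_terminal_graphs_def by blast
  qed
  have best: "split_reliability H p \<le> split_reliability G p"
    if H: "H \<in> two_terminal_graphs n m" and p: "p \<in> {0..1}" for H p
  proof -
    have "iso_rel `` {H} \<in> T n m" using H unfolding T_def by (rule quotientI)
    moreover have "H \<in> iso_rel `` {H}" using H refl unfolding two_terminal_graphs_def by blast
    ultimately show ?thesis
      using C(2) G(2) p unfolding uniformly_most_split_reliable_def by blast
  qed
  let ?V = "verts G" and ?E = "edges G" and ?s = "source G" and ?t = "sink G"
  let ?b = "card (bridges ?V ?E ?s ?t)"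
  have GT: "is_two_terminal_graph G" "card ?V = n" "card ?E = m"
    using G(1) by (auto simp: two_terminal_graphs_def)
  interpret G: terminal_graph ?V ?E ?s ?t
    using GT(1) by (simp add: is_two_terminal_graph_iff)
  \<comment> \<open>Of the optimality only the comparison of the two leading coefficients is kept,
    those at p = 0 and p = 1.\<close>
  have cmp: "card (forests V E s t) \<le> card (forests ?V ?E ?s ?t)"
      "card (bridges V E s t) \<le> ?b"
    if H: "terminal_graph V E s t" "card V = n" "card E = m" for V E and s t :: nat
  proof -
    define H where "H = \<lparr>verts = V, edges = E, source = s, sink = t\<rparr>"
    have HT: "is_two_terminal_graph H"
      using that unfolding is_two_terminal_graph_iff H_def by simp
    then have HH: "H \<in> two_terminal_graphs n m"
      using that unfolding two_terminal_graphs_def H_def by simp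
    have eq: "card (verts H) = card ?V" "card (edges H) = card ?E"
      using that GT unfolding H_def by simp_all
    show "card (forests V E s t) \<le> card (forests ?V ?E ?s ?t)" "card (bridges V E s t) \<le> ?b"
      using card_le_of_split_reliability_le[OF GT(1) HT eq best[OF HH]] unfolding H_def by simp_all
  qed
  have many: "c \<le> ?b" if c: "c + 2 \<le> n" "m \<le> ((n - c) choose 2) + c" for c
  proof -
    obtain E where E: "terminal_graph {..<n} E 0 (n - 1)" "card E = m"
      "c \<le> card (bridges {..<n} E 0 (n - 1))"
      using exists_graph_with_bridges[OF c(1) _ c(2)] assms(2) by auto
    then show ?thesis using cmp(2)[OF E(1) _ E(2)] by simp
  qed
  \<comment> \<open>The upper bound on \<open>m\<close> enters here, through a path of 3
    edges.\<close>
  have "3 \<le> ?b" using many[of 3] assms by simp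
  moreover have "((n - (?b + 1)) choose 2) + (?b + 1) < m" if "?b + 3 \<le> n"
  proof (rule ccontr)
    assume "\<not> ?thesis"
    then have "?b + 1 \<le> ?b" using many[of "?b + 1"] that by simp
    then show False by simp
  qed
  ultimately have "m - ?b \<le> (?b - 1) * (m - n + 1) + 1"
    using bridge_count_arith assms(2) by blast
  then obtain E s t where "terminal_graph ?V E s t" "card E = m"
    "card (forests ?V ?E ?s ?t) < card (forests ?V E s t)"
    using G.more_forests GT(2,3) assms(2) \<open>3 \<le> ?b\<close> by auto
  then show False using cmp(1)[of ?V E s t] GT(2) by simp
qed

end
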